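(* Let $n\ge1$ and $\bm r\in\mathbb R^n$. On the canonical probe $|\psi_{\bm r}\rangle$, in the ordered passive basis $\{\hat g_j^{\mathrm{rot}}\}_{j=1}^n\cup\{\hat g_{jk}^{\mathrm{bsX}},\hat g_{jk}^{\mathrm{bsY}}\}_{1\le j<k\le n}$, the passive mean-commutator tensor has the direct-sum form $$\bm{\mathcal C}_{\mathrm{passive}}=\bm 0_n\oplus\bigoplus_{1\le j<k\le n}\begin{pmatrix}0&\mathcal C_{jk}\\-\mathcal C_{jk}&0\end{pmatrix},\qquad \mathcal C_{jk}:=\mathcal C_{\mathrm{bsX}_{jk},\mathrm{bsY}_{jk}}=\sinh(r_j+r_k)\sinh(r_j-r_k).$$ In particular $\mathcal C_{jk}=0$ precisely when $r_j=r_k$ or $r_j=-r_k$. Moreover $$\mathcal C_{jk}^2=\tfrac1{16}F_{jk}^{\mathrm{bsX}}F_{jk}^{\mathrm{bsY}},$$ so for every mode pair $j<k$, whenever both Fisher weights $F_{jk}^{\mathrm{bsX}}$ and $F_{jk}^{\mathrm{bsY}}$ are positive one has $\mathcal C_{jk}\ne0$; hence there is no spectrum $\bm r$ for which both beam-splitter quadratures of one mode pair are simultaneously identifiable and weakly commuting.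
   Context: Bosonic modes: on the Fock space of $n$ bosonic modes let $\hat a_j,\hat a_j^\dagger$ be the annihilation and creation operators, $[\hat a_j,\hat a_k^\dagger]=\delta_{jk}$, and $|0\rangle$ the vacuum. For $\bm r\in\mathbb R^n$ the canonical probe is $|\psi_{\bm r}\rangle=\hat S(\bm r)|0\rangle$ with $\hat S(\bm r)=\prod_{j=1}^n \exp\!\big[\tfrac12 r_j(\hat a_j^2-\hat a_j^{\dagger 2})\big]$. Passive generators: $\hat g_j^{\mathrm{rot}}=\hat a_j^\dagger\hat a_j$ ($1\le j\le n$); $\hat g_{jk}^{\mathrm{bsX}}=\hat a_j^\dagger\hat a_k+\hat a_k^\dagger\hat a_j$ and $\hat g_{jk}^{\mathrm{bsY}}=-i(\hat a_j^\dagger\hat a_k-\hat a_k^\dagger\hat a_j)$ ($1\le j<k\le n$). With expectation values in $|\psi_{\bm r}\rangle$, the mean-commutator tensor is $\mathcal C_{\mu\nu}=\frac1{2i}\langle[\hat g_\mu,\hat g_\nu]\rangle$, and the Fisher weight of a generator is $F_{\mu\mu}=4\langle(\hat g_\mu-\langle\hat g_\mu\rangle)^2\rangle$; $F_{jk}^{\mathrm{bsX}},F_{jk}^{\mathrm{bsY}}$ are the Fisher weights of $\hat g_{jk}^{\mathrm{bsX}},\hat g_{jk}^{\mathrm{bsY}}$. A generator is identifiable when its Fisher weight is positive; two generators weakly commute when $\mathcal C_{\mu\nu}=0$. *)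

theory Defs
  imports "HOL-Library.Cardinality" "HOL-Analysis.Infinite_Sum" "Jordan_Normal_Form.Matrix"
begin

text \<open>The modes are the elements of a finite linearly ordered type \<open>'n\<close>; \<open>n\<close> is \<open>CARD('n) \<ge> 1\<close>.
  A state is given by its coefficients in the occupation-number basis: \<open>f m\<close> is the amplitude of
  \<open>|m\<rangle>\<close>, where \<open>m j\<close> is the number of quanta in mode \<open>j\<close>.\<close>

type_synonym 'n fock = "('n \<Rightarrow> nat) \<Rightarrow> complex"
type_synonym 'n fock_op = "'n fock \<Rightarrow> 'n fock"

definition fock_space :: "'n fock set" where
  "fock_space = {f. (\<lambda>m. (cmod (f m))\<^sup>2) summable_on UNIV}"

definition fock_norm :: "'n fock \<Rightarrow> real" where
  "fock_norm f = sqrt (\<Sum>\<^sub>\<infinity>m. (cmod (f m))\<^sup>2)"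

definition fock_inner :: "'n fock \<Rightarrow> 'n fock \<Rightarrow> complex" where
  "fock_inner f g = (\<Sum>\<^sub>\<infinity>m. cnj (f m) * g m)"

definition finite_particle :: "'n fock set" where
  "finite_particle = {f. finite {m. f m \<noteq> 0}}"

definition vacuum :: "'n fock" where
  "vacuum = (\<lambda>m. if m = (\<lambda>_. 0) then 1 else 0)"

text \<open>Coefficient form of \<open>a|k\<rangle> = \<surd>k |k-1\<rangle>\<close> and \<open>a\<^sup>\<dagger>|k\<rangle> = \<surd>(k+1) |k+1\<rangle>\<close>.
  For \<open>m j = 0\<close> the factor in \<open>creation\<close> vanishes, so truncated subtraction is harmless.\<close>

definition annihilation :: "'n \<Rightarrow> 'n fock_op" where
  "annihilation j f = (\<lambda>m. of_real (sqrt (real (m j) + 1)) * f (m(j := m j + 1)))"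

definition creation :: "'n \<Rightarrow> 'n fock_op" where
  "creation j f = (\<lambda>m. of_real (sqrt (real (m j))) * f (m(j := m j - 1)))"

text \<open>Graph of the closure of the restriction of \<open>A\<close> to finite-particle vectors. Membership in
  \<open>fock_space\<close> is demanded explicitly because \<open>fock_norm\<close> is \<open>0\<close> on non-summable arguments.\<close>

definition op_closure :: "'n fock_op \<Rightarrow> ('n fock \<times> 'n fock) set" where
  "op_closure A = {(f, h). f \<in> fock_space \<and> h \<in> fock_space \<and>
     (\<exists>g. (\<forall>k::nat. g k \<in> finite_particle \<and> A (g k) \<in> fock_space) \<and>
          (\<lambda>k. fock_norm (\<lambda>m. g k m - f m)) \<longlonglongrightarrow> 0 \<and>
          (\<lambda>k. fock_norm (\<lambda>m. A (g k) m - h m)) \<longlonglongrightarrow> 0)}"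

text \<open>\<open>u\<close> is a norm-differentiable curve with \<open>u' = cl(A) u\<close>, where \<open>cl(A)\<close> is the closure of \<open>A\<close>.\<close>

definition evolution_curve :: "'n fock_op \<Rightarrow> (real \<Rightarrow> 'n fock) \<Rightarrow> bool" where
  "evolution_curve A u \<longleftrightarrow>
     (\<forall>t. \<exists>h. (u t, h) \<in> op_closure A \<and>
        ((\<lambda>s. fock_norm (\<lambda>m. (u s m - u t m) / of_real (s - t) - h m)) \<longlongrightarrow> 0) (at t))"

text \<open>The exponential of an unbounded operator. The squeezing generators below are essentially
  skew-adjoint on finite-particle vectors (these are analytic vectors), so their closures generate
  strongly continuous one-parameter unitary groups \<open>exp(t cl(A))\<close>; for \<open>f\<close> in the domain of \<open>cl(A)\<close> the
  orbit \<open>exp(t cl(A)) f\<close> is the unique solution of \<open>u' = cl(A) u\<close>, \<open>u 0 = f\<close>. The power series of \<open>exp\<close>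
  cannot be used: on the vacuum it diverges for large squeezing. Outside the domain of \<open>cl(A)\<close>
  the value is irrelevant.\<close>

definition op_exp :: "'n fock_op \<Rightarrow> 'n fock_op" where
  "op_exp A f = (THE g. \<exists>u. evolution_curve A u \<and> u 0 = f \<and> u 1 = g)"

definition squeeze_gen :: "real \<Rightarrow> 'n \<Rightarrow> 'n fock_op" where
  "squeeze_gen s j f = (\<lambda>m. of_real (s / 2) *
     (annihilation j (annihilation j f) m - creation j (creation j f) m))"

definition modes :: "'n::{finite,linorder} list" where
  "modes = sorted_list_of_set UNIV"

text \<open>The factors commute; they are composed in the order of the modes.\<close>

definition squeezer :: "('n::{finite,linorder} \<Rightarrow> real) \<Rightarrow> 'n fock_op" where
  "squeezer r = foldr (\<lambda>j S. op_exp (squeeze_gen (r j) j) \<circ> S) modes id"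

definition probe :: "('n::{finite,linorder} \<Rightarrow> real) \<Rightarrow> 'n fock" where
  "probe r = squeezer r vacuum"

datatype 'n generator = Rot 'n | BsX 'n 'n | BsY 'n 'n

fun passive_op :: "'n generator \<Rightarrow> 'n fock_op" where
  "passive_op (Rot j) f = creation j (annihilation j f)"
| "passive_op (BsX j k) f =
     (\<lambda>m. creation j (annihilation k f) m + creation k (annihilation j f) m)"
| "passive_op (BsY j k) f =
     (\<lambda>m. - \<i> * (creation j (annihilation k f) m - creation k (annihilation j f) m))"

definition mode_pairs :: "('n::{finite,linorder} \<times> 'n) list" where
  "mode_pairs = [(j, k). j \<leftarrow> modes, k \<leftarrow> modes, j < k]"

definition passive_basis :: "'n::{finite,linorder} generator list" where
  "passive_basis = map Rot modes @ concat (map (\<lambda>(j, k). [BsX j k, BsY j k]) mode_pairs)"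

definition expval :: "'n fock \<Rightarrow> 'n fock_op \<Rightarrow> complex" where
  "expval \<psi> A = fock_inner \<psi> (A \<psi>)"

definition commutator :: "'n fock_op \<Rightarrow> 'n fock_op \<Rightarrow> 'n fock_op" where
  "commutator A B f = (\<lambda>m. A (B f) m - B (A f) m)"

definition mean_comm ::
  "('n::{finite,linorder} \<Rightarrow> real) \<Rightarrow> 'n generator \<Rightarrow> 'n generator \<Rightarrow> complex" where
  "mean_comm r \<mu> \<nu> =
     1 / (2 * \<i>) * expval (probe r) (commutator (passive_op \<mu>) (passive_op \<nu>))"

definition passive_tensor :: "('n::{finite,linorder} \<Rightarrow> real) \<Rightarrow> complex mat" where
  "passive_tensor r =
     mat (length (passive_basis :: 'n generator list)) (length (passive_basis :: 'n generator list))
       (\<lambda>(p, q). mean_comm r (passive_basis ! p) (passive_basis ! q))"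

definition centred :: "('n::{finite,linorder} \<Rightarrow> real) \<Rightarrow> 'n generator \<Rightarrow> 'n fock_op" where
  "centred r \<mu> f = (\<lambda>m. passive_op \<mu> f m - expval (probe r) (passive_op \<mu>) * f m)"

text \<open>The expectation of the square is real, since the generators are symmetric.\<close>

definition fisher_weight :: "('n::{finite,linorder} \<Rightarrow> real) \<Rightarrow> 'n generator \<Rightarrow> real" where
  "fisher_weight r \<mu> = 4 * Re (expval (probe r) (centred r \<mu> \<circ> centred r \<mu>))"

definition identifiable :: "('n::{finite,linorder} \<Rightarrow> real) \<Rightarrow> 'n generator \<Rightarrow> bool" where
  "identifiable r \<mu> \<longleftrightarrow> fisher_weight r \<mu> > 0"

definition weakly_commuting ::
  "('n::{finite,linorder} \<Rightarrow> real) \<Rightarrow> 'n generator \<Rightarrow> 'n generator \<Rightarrow> bool" where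
  "weakly_commuting r \<mu> \<nu> \<longleftrightarrow> mean_comm r \<mu> \<nu> = 0"

end

theory Submission
  imports Defs "HOL-Analysis.L2_Norm" "HOL-Analysis.Derivative"
begin

text \<open>The product state \<open>\<psi>\<close> whose factors have amplitudes proportional to
  \<open>(- tanh r)^k sqrt ((2k)!) / (2^k k!)\<close> at \<open>2k\<close> quanta solves the squeezing evolution equation in each
  mode. The squeezing generators being skew, evolution curves have constant norm; hence they are
  unique, the probe is \<open>\<psi>\<close>, and \<open>\<psi>\<close> is a unit vector.
  On \<open>\<psi>\<close> the recursion for the amplitudes reads \<open>a\<^sub>j \<psi> = - tanh r\<^sub>j a\<^sub>j\<^sup>\<dagger> \<psi>\<close>. Every passive generator thus maps
  \<open>\<psi>\<close> to a multiple of a pair excitation \<open>a\<^sub>j\<^sup>\<dagger> a\<^sub>k\<^sup>\<dagger> \<psi>\<close>: the multiples \<open>-(tanh r\<^sub>j + tanh r\<^sub>k)\<close> and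
  \<open>-i (tanh r\<^sub>j - tanh r\<^sub>k)\<close> for the two beam-splitter quadratures. Excitations of different pairs have
  different occupation parities, so they are orthogonal, and \<open>\<parallel>a\<^sub>j\<^sup>\<dagger> a\<^sub>k\<^sup>\<dagger> \<psi>\<parallel> = cosh r\<^sub>j cosh r\<^sub>k\<close>.\<close>

section \<open>Square-summable amplitudes\<close>

lemma fock_norm_nonneg [simp]: "0 \<le> fock_norm f"
  by (simp add: fock_norm_def infsum_nonneg)

lemma fock_norm_sq:
  "(fock_norm f)\<^sup>2 = (\<Sum>\<^sub>\<infinity>m. (cmod (f m))\<^sup>2)"
  by (simp add: fock_norm_def infsum_nonneg)

lemma L2_set_le_fock_norm:
  assumes "f \<in> fock_space" "finite F"
  shows "L2_set (\<lambda>m. cmod (f m)) F \<le> fock_norm f"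
  unfolding L2_set_def fock_norm_def
  using assms by (intro real_sqrt_le_mono finite_sum_le_infsum) (auto simp: fock_space_def)

text \<open>A uniform bound on the finite partial sums gives summability and the norm bound at once,
  so later estimates can be made with \<open>L2_set\<close> on finite sets.\<close>

lemma fock_norm_leI:
  assumes "\<And>F. finite F \<Longrightarrow> L2_set (\<lambda>m. cmod (f m)) F \<le> B"
  shows "f \<in> fock_space" and "fock_norm f \<le> B"
proof -
  have B: "0 \<le> B" using assms[of "{}"] by simp
  have *: "(\<Sum>m\<in>F. (cmod (f m))\<^sup>2) \<le> B\<^sup>2" if "finite F" for F
    using assms[OF that] unfolding L2_set_def by (simp add: sqrt_le_D)
  show f: "f \<in> fock_space"
    unfolding fock_space_def mem_Collect_eq
    by (rule nonneg_bdd_above_summable_on) (auto intro!: bdd_aboveI[where M = "B\<^sup>2"] *)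
  then have "(\<Sum>\<^sub>\<infinity>m. (cmod (f m))\<^sup>2) \<le> B\<^sup>2"
    by (intro infsum_le_finite_sums) (auto simp: fock_space_def intro: *)
  then show "fock_norm f \<le> B"
    unfolding fock_norm_def using B by (simp add: real_le_lsqrt infsum_nonneg)
qed

text \<open>Minkowski's inequality on finite sets, carried over to the full sum by
  \<open>fock_norm_leI\<close>.\<close>

lemma fock_norm_add:
  assumes "f \<in> fock_space" "g \<in> fock_space"
  shows fock_space_add: "(\<lambda>m. f m + g m) \<in> fock_space"
    and fock_norm_triangle: "fock_norm (\<lambda>m. f m + g m) \<le> fock_norm f + fock_norm g"
proof -
  have *: "L2_set (\<lambda>m. cmod (f m + g m)) F \<le> fock_norm f + fock_norm g" if F: "finite F" for F
  proof -
    have "L2_set (\<lambda>m. cmod (f m + g m)) F \<le> L2_set (\<lambda>m. cmod (f m) + cmod (g m)) F"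
      by (intro L2_set_mono norm_triangle_ineq) auto
    also have "\<dots> \<le> L2_set (\<lambda>m. cmod (f m)) F + L2_set (\<lambda>m. cmod (g m)) F"
      by (rule L2_set_triangle_ineq)
    also have "\<dots> \<le> fock_norm f + fock_norm g"
      using assms F by (intro add_mono L2_set_le_fock_norm)
    finally show ?thesis .
  qed
  show "(\<lambda>m. f m + g m) \<in> fock_space" "fock_norm (\<lambda>m. f m + g m) \<le> fock_norm f + fock_norm g"
    using fock_norm_leI[OF *] by auto
qed

lemma fock_space_scale: "f \<in> fock_space \<Longrightarrow> (\<lambda>m. c * f m) \<in> fock_space"
  unfolding fock_space_def by (simp add: norm_mult power_mult_distrib summable_on_cmult_right)

lemma fock_norm_scale: "fock_norm (\<lambda>m. c * f m) = cmod c * fock_norm f"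
  by (simp add: fock_norm_def norm_mult power_mult_distrib infsum_cmult_right' real_sqrt_mult)

lemma fock_space_diff:
  assumes "f \<in> fock_space" "g \<in> fock_space"
  shows "(\<lambda>m. f m - g m) \<in> fock_space"
  using fock_space_add[OF assms(1) fock_space_scale[OF assms(2), of "-1"]] by simp

lemma fock_norm_diff_le:
  assumes "f \<in> fock_space" "g \<in> fock_space"
  shows "\<bar>fock_norm f - fock_norm g\<bar> \<le> fock_norm (\<lambda>m. f m - g m)"
proof -
  have 1: "fock_norm f \<le> fock_norm g + fock_norm (\<lambda>m. f m - g m)"
    using fock_norm_triangle[OF assms(2) fock_space_diff[OF assms]] by simp
  have 2: "fock_norm g \<le> fock_norm f + fock_norm (\<lambda>m. g m - f m)"
    using fock_norm_triangle[OF assms(1) fock_space_diff[OF assms(2,1)]] by simp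
  have "fock_norm (\<lambda>m. g m - f m) = fock_norm (\<lambda>m. f m - g m)"
    using fock_norm_scale[of "-1" "\<lambda>m. f m - g m"] by simp
  with 1 2 show ?thesis by simp
qed

lemma fock_norm_eq_0_imp:
  assumes "f \<in> fock_space" "fock_norm f = 0"
  shows "f = (\<lambda>_. 0)"
proof
  fix m
  have "L2_set (\<lambda>m. cmod (f m)) {m} \<le> 0"
    using L2_set_le_fock_norm[OF assms(1), of "{m}"] assms(2) by simp
  then show "f m = 0" by simp
qed

text \<open>Absolute summability by comparison, from \<open>2xy \<le> x^2 + y^2\<close> for the
  moduli.\<close>

lemma fock_inner_summable:
  assumes "f \<in> fock_space" "g \<in> fock_space"
  shows "(\<lambda>m. cnj (f m) * g m) summable_on UNIV"
proof -
  have "(\<lambda>m. (cmod (f m))\<^sup>2 + (cmod (g m))\<^sup>2) summable_on UNIV"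
    using assms unfolding fock_space_def by (intro summable_on_add) auto
  then have "(\<lambda>m. norm (cnj (f m) * g m)) summable_on UNIV"
  proof (rule summable_on_comparison_test)
    show "norm (cnj (f m) * g m) \<le> (cmod (f m))\<^sup>2 + (cmod (g m))\<^sup>2" for m
      using sum_squares_bound[of "cmod (f m)" "cmod (g m)"]
        mult_nonneg_nonneg[of "cmod (f m)" "cmod (g m)"]
      by (simp add: norm_mult del: mult_nonneg_nonneg)
  qed auto
  then show ?thesis by (rule abs_summable_summable)
qed

lemma fock_inner_add_right:
  assumes "f \<in> fock_space" "g \<in> fock_space" "h \<in> fock_space"
  shows "fock_inner f (\<lambda>m. g m + h m) = fock_inner f g + fock_inner f h"
  unfolding fock_inner_def
  using infsum_add[OF fock_inner_summable[OF assms(1,2)] fock_inner_summable[OF assms(1,3)]]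
  by (simp add: distrib_left)

lemma fock_inner_scale_right: "fock_inner f (\<lambda>m. c * g m) = c * fock_inner f g"
  unfolding fock_inner_def by (simp add: infsum_cmult_right' mult.left_commute)

lemma fock_inner_commute: "fock_inner g f = cnj (fock_inner f g)"
  unfolding fock_inner_def by (simp flip: infsum_cnj add: mult.commute)

lemma fock_inner_diff_right:
  assumes "f \<in> fock_space" "g \<in> fock_space" "h \<in> fock_space"
  shows "fock_inner f (\<lambda>m. g m - h m) = fock_inner f g - fock_inner f h"
  using fock_inner_add_right[OF assms(1,2) fock_space_scale[OF assms(3), of "-1"]]
    fock_inner_scale_right[of f "-1" h] by simp

lemma fock_inner_scale_left: "fock_inner (\<lambda>m. c * f m) g = cnj c * fock_inner f g"
  using fock_inner_commute[of "\<lambda>m. c * f m" g] fock_inner_commute[of f g]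
  by (simp add: fock_inner_scale_right)

lemma fock_inner_self:
  assumes "f \<in> fock_space"
  shows "fock_inner f f = complex_of_real ((fock_norm f)\<^sup>2)"
proof -
  have "cnj (f m) * f m = complex_of_real ((cmod (f m))\<^sup>2)" for m
    by (metis complex_norm_square mult.commute of_real_power)
  moreover have "((\<lambda>m. complex_of_real ((cmod (f m))\<^sup>2)) has_sum
      complex_of_real (\<Sum>\<^sub>\<infinity>m. (cmod (f m))\<^sup>2)) UNIV"
    using assms unfolding fock_space_def mem_Collect_eq
    by (intro has_sum_of_real has_sum_infsum)
  ultimately show ?thesis
    unfolding fock_inner_def fock_norm_sq by (simp only: infsumI)
qed

lemma fock_inner_add_left:
  assumes "f \<in> fock_space" "g \<in> fock_space" "h \<in> fock_space"
  shows "fock_inner (\<lambda>m. f m + g m) h = fock_inner f h + fock_inner g h"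
  using fock_inner_add_right[OF assms(3,1,2)]
  by (metis complex_cnj_add fock_inner_commute)

lemma fock_norm_add_sq:
  assumes "f \<in> fock_space" "g \<in> fock_space"
  shows "(fock_norm (\<lambda>m. f m + g m))\<^sup>2 = (fock_norm f)\<^sup>2 + (fock_norm g)\<^sup>2 + 2 * Re (fock_inner f g)"
proof -
  note S = assms fock_space_add[OF assms]
  have "fock_inner (\<lambda>m. f m + g m) (\<lambda>m. f m + g m)
      = fock_inner f f + fock_inner f g + (fock_inner g f + fock_inner g g)"
    using S by (simp add: fock_inner_add_left fock_inner_add_right)
  then have "Re (complex_of_real ((fock_norm (\<lambda>m. f m + g m))\<^sup>2))
     = Re (complex_of_real ((fock_norm f)\<^sup>2) + fock_inner f g + (cnj (fock_inner f g) + complex_of_real ((fock_norm g)\<^sup>2)))"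
    by (simp only: fock_inner_self[OF S(1)] fock_inner_self[OF S(2)] fock_inner_self[OF S(3)]
        fock_inner_commute[of g f])
  then show ?thesis by simp
qed

section \<open>Exponentially decaying amplitudes\<close>

lemma sum_fun_upd_UNIV:
  fixes m :: "'n::finite \<Rightarrow> nat"
  shows "(\<Sum>i\<in>UNIV. (m(j := x)) i) + m j = (\<Sum>i\<in>UNIV. m i) + x"
proof -
  have "(\<Sum>i\<in>UNIV. (m(j := x)) i) = x + (\<Sum>i\<in>UNIV - {j}. m i)"
    by (subst sum.remove[of _ j]) (auto intro!: sum.cong)
  moreover have "(\<Sum>i\<in>UNIV. m i) = m j + (\<Sum>i\<in>UNIV - {j}. m i)"
    by (subst sum.remove[of _ j]) auto
  ultimately show ?thesis by simp
qed

text \<open>The exponent is the total number of quanta, so one ratio serves all modes and a ladder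
  operator shifts the exponent by exactly one.\<close>

definition geom_bound :: "real \<Rightarrow> real \<Rightarrow> 'n::finite fock \<Rightarrow> bool" where
  "geom_bound \<rho> C f \<longleftrightarrow> (\<forall>m. cmod (f m) \<le> C * \<rho> ^ (\<Sum>i\<in>UNIV. m i))"

lemma geom_boundD: "geom_bound \<rho> C f \<Longrightarrow> cmod (f m) \<le> C * \<rho> ^ (\<Sum>i\<in>UNIV. m i)"
  by (simp add: geom_bound_def)

lemma geom_bound_nonneg: "geom_bound \<rho> C f \<Longrightarrow> 0 \<le> C"
  using geom_boundD[of \<rho> C f "\<lambda>_. 0"] norm_ge_zero[of "f (\<lambda>_. 0)"]
  by (auto intro: order_trans[OF norm_ge_zero])

lemma geom_bound_mono:
  assumes "geom_bound \<rho> C f" "0 \<le> \<rho>" "\<rho> \<le> \<rho>'" "C \<le> C'"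
  shows "geom_bound \<rho>' C' f"
  unfolding geom_bound_def
proof
  fix m
  have "cmod (f m) \<le> C * \<rho> ^ (\<Sum>i\<in>UNIV. m i)" by (rule geom_boundD[OF assms(1)])
  also have "\<dots> \<le> C' * \<rho>' ^ (\<Sum>i\<in>UNIV. m i)"
    using assms geom_bound_nonneg[OF assms(1)] by (intro mult_mono power_mono) auto
  finally show "cmod (f m) \<le> C' * \<rho>' ^ (\<Sum>i\<in>UNIV. m i)" .
qed

lemma geom_bound_add:
  assumes "geom_bound \<rho> C f" "geom_bound \<rho> D g"
  shows "geom_bound \<rho> (C + D) (\<lambda>m. f m + g m)"
  using assms unfolding geom_bound_def
  by (metis (no_types, lifting) distrib_right norm_triangle_mono)

lemma geom_bound_scale:
  assumes "geom_bound \<rho> C f"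
  shows "geom_bound \<rho> (cmod c * C) (\<lambda>m. c * f m)"
  using assms unfolding geom_bound_def by (simp add: norm_mult mult.assoc mult_left_mono)

text \<open>A common domain that the ladder operators preserve and that contains the finite-particle
  vectors and the squeezed states. On it all operator products stay square-summable, so inner
  products can be rearranged freely.\<close>

definition decaying :: "'n::finite fock set" where
  "decaying = {f. \<exists>\<rho> C. 0 < \<rho> \<and> \<rho> < 1 \<and> geom_bound \<rho> C f}"

text \<open>A finite set of occupation patterns lies in a cube with side \<open>{..N}\<close>, where
  the sum factors into one geometric sum per mode. The bound is independent of
  \<open>F\<close>.\<close>

lemma sum_geometric_power_le:
  fixes q :: real and F :: "('n::finite \<Rightarrow> nat) set"
  assumes q: "0 \<le> q" "q < 1" and F: "finite F"
  shows "(\<Sum>m\<in>F. q ^ (\<Sum>i\<in>UNIV. m i)) \<le> (1 / (1 - q)) ^ CARD('n)"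
proof -
  have "finite (\<Union>m\<in>F. range m)" using F by auto
  then obtain N where N: "(\<Union>m\<in>F. range m) \<subseteq> {..N}"
    using finite_nat_iff_bounded_le by auto
  have sub: "F \<subseteq> PiE UNIV (\<lambda>_. {..N})"
    using N by (auto simp: PiE_def)
  have "(\<Sum>m\<in>F. q ^ (\<Sum>i\<in>UNIV. m i)) \<le> (\<Sum>m\<in>PiE (UNIV::'n set) (\<lambda>_. {..N}). \<Prod>i\<in>UNIV. q ^ m i)"
    unfolding power_sum
  proof (rule sum_mono2)
    show "finite (PiE (UNIV::'n set) (\<lambda>_. {..N}))" by (intro finite_PiE) auto
  qed (use sub q in \<open>auto intro: prod_nonneg\<close>)
  also have "\<dots> = (\<Prod>i\<in>(UNIV::'n set). \<Sum>k\<le>N. q ^ k)"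
    by (rule prod_sum_PiE[symmetric]) auto
  also have "\<dots> \<le> (\<Prod>i\<in>(UNIV::'n set). 1 / (1 - q))"
  proof (intro prod_mono conjI sum_nonneg)
    show "(\<Sum>k\<le>N. q ^ k) \<le> 1 / (1 - q)"
      using sum_le_suminf[OF summable_geometric[of q], of "{..N}"] suminf_geometric[of q] q by simp
  qed (use q in auto)
  finally show ?thesis by simp
qed

text \<open>The squared amplitudes are dominated by a geometric series of ratio
  \<open>\<rho>^2\<close> in each mode. That the bound is linear in \<open>C\<close> turns small
  constants into small norms in the limit arguments below.\<close>

lemma geom_bound_fock_norm:
  fixes f :: "'n::finite fock"
  assumes f: "geom_bound \<rho> C f" and \<rho>: "0 < \<rho>" "\<rho> < 1"
  shows "f \<in> fock_space" and "fock_norm f \<le> C * sqrt ((1 / (1 - \<rho>\<^sup>2)) ^ CARD('n))"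
proof -
  have q: "\<rho>\<^sup>2 < 1" using \<rho> by (simp add: power_less_one_iff)
  have C: "0 \<le> C" by (rule geom_bound_nonneg[OF f])
  have *: "L2_set (\<lambda>m. cmod (f m)) F \<le> C * sqrt ((1 / (1 - \<rho>\<^sup>2)) ^ CARD('n))" if F: "finite F" for F
  proof -
    have "L2_set (\<lambda>m. cmod (f m)) F \<le> L2_set (\<lambda>m. C * \<rho> ^ (\<Sum>i\<in>UNIV. m i)) F"
      by (intro L2_set_mono geom_boundD[OF f]) auto
    also have "\<dots> = C * L2_set (\<lambda>m. \<rho> ^ (\<Sum>i\<in>UNIV. m i)) F"
      using C by (simp add: L2_set_right_distrib)
    also have "L2_set (\<lambda>m. \<rho> ^ (\<Sum>i\<in>UNIV. m i)) F \<le> sqrt ((1 / (1 - \<rho>\<^sup>2)) ^ CARD('n))"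
      using sum_geometric_power_le[OF _ q F]
      unfolding L2_set_def by (simp add: power_mult[symmetric] mult.commute)
    finally show ?thesis using C by (simp add: mult_left_mono)
  qed
  show "f \<in> fock_space" "fock_norm f \<le> C * sqrt ((1 / (1 - \<rho>\<^sup>2)) ^ CARD('n))"
    using fock_norm_leI[OF *] by auto
qed

lemma decaying_fock_space: "f \<in> decaying \<Longrightarrow> f \<in> fock_space"
  by (auto simp: decaying_def dest: geom_bound_fock_norm)

lemma decaying_add:
  assumes "f \<in> decaying" "g \<in> decaying"
  shows "(\<lambda>m. f m + g m) \<in> decaying"
proof -
  obtain \<rho> C \<sigma> D where *: "0 < \<rho>" "\<rho> < 1" "geom_bound \<rho> C f" "0 < \<sigma>" "\<sigma> < 1" "geom_bound \<sigma> D g"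
    using assms unfolding decaying_def by auto
  have "geom_bound (max \<rho> \<sigma>) (C + D) (\<lambda>m. f m + g m)"
    using * by (intro geom_bound_add geom_bound_mono[OF *(3)] geom_bound_mono[OF *(6)]) auto
  then show ?thesis
    unfolding decaying_def mem_Collect_eq using *
    by (intro exI[of _ "max \<rho> \<sigma>"] exI[of _ "C + D"]) auto
qed

lemma decaying_scale: "f \<in> decaying \<Longrightarrow> (\<lambda>m. c * f m) \<in> decaying"
  unfolding decaying_def by (blast intro: geom_bound_scale)

lemma decaying_diff:
  assumes "f \<in> decaying" "g \<in> decaying"
  shows "(\<lambda>m. f m - g m) \<in> decaying"
  using decaying_add[OF assms(1) decaying_scale[OF assms(2), of "-1"]] by simp

text \<open>The sequence \<open>k q^k + q^k\<close> tends to 0, hence is bounded, and it dominates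
  the sequence in question.\<close>

lemma sqrt_times_power_bounded:
  fixes q :: real
  assumes "0 \<le> q" "q < 1"
  obtains K where "0 \<le> K" "\<And>k::nat. sqrt (real k + 1) * q ^ k \<le> K"
proof -
  have "(\<lambda>k. real k * q ^ k + q ^ k) \<longlonglongrightarrow> 0 + 0"
    using assms by (intro tendsto_add powser_times_n_limit_0 LIMSEQ_power_zero) auto
  then have "Bseq (\<lambda>k. real k * q ^ k + q ^ k)"
    by (intro convergent_imp_Bseq convergentI)
  then obtain K where K: "0 < K" "\<And>k. norm (real k * q ^ k + q ^ k) \<le> K"
    by (auto elim: BseqE)
  have "sqrt (real k + 1) * q ^ k \<le> K" for k
  proof -
    have "sqrt (real k + 1) \<le> real k + 1" by (rule real_le_lsqrt) (auto simp: power2_eq_square)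
    then have "sqrt (real k + 1) * q ^ k \<le> (real k + 1) * q ^ k"
      using assms by (intro mult_right_mono) auto
    also have "\<dots> \<le> K" using K(2)[of k] by (simp add: distrib_right)
    finally show ?thesis .
  qed
  with K(1) show ?thesis by (intro that[of K]) auto
qed

text \<open>The unbounded factor \<open>sqrt (m j + 1)\<close> is absorbed by passing from the ratio
  \<rho> to the larger \<rho>'. The constant \<open>L\<close> is uniform in \<open>j\<close>,
  \<open>C\<close> and \<open>f\<close>, which makes the loss controllable in limits.\<close>

lemma geom_bound_ladder:
  assumes "0 < \<rho>" "\<rho> < \<rho>'"
  obtains L where "0 \<le> L"
    "\<And>j C f. geom_bound \<rho> C (f::'n::finite fock) \<Longrightarrow> geom_bound \<rho>' (L * C) (annihilation j f)"
    "\<And>j C f. geom_bound \<rho> C (f::'n::finite fock) \<Longrightarrow> geom_bound \<rho>' (L * C) (creation j f)"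
proof -
  define q where "q = \<rho> / \<rho>'"
  have q: "0 < q" "q < 1" using assms by (auto simp: q_def)
  have \<rho>: "\<rho> = \<rho>' * q" using assms by (simp add: q_def)
  have \<rho>': "0 < \<rho>'" using assms by simp
  obtain K where K: "0 \<le> K" "\<And>k::nat. sqrt (real k + 1) * q ^ k \<le> K"
    using sqrt_times_power_bounded[of q] q by (metis less_imp_le)
  have main: "sqrt (real (m j) + 1) * (C * \<rho> ^ (\<Sum>i\<in>UNIV. m i)) \<le> K * C * \<rho>' ^ (\<Sum>i\<in>UNIV. m i)"
    if C: "0 \<le> C" for C j and m :: "'n \<Rightarrow> nat"
  proof -
    have "m j \<le> (\<Sum>i\<in>UNIV. m i)" by (rule member_le_sum) auto
    then have "q ^ (\<Sum>i\<in>UNIV. m i) \<le> q ^ m j" using q by (intro power_decreasing) auto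
    then have "sqrt (real (m j) + 1) * q ^ (\<Sum>i\<in>UNIV. m i) \<le> sqrt (real (m j) + 1) * q ^ m j"
      by (intro mult_left_mono) auto
    also have "\<dots> \<le> K" by (rule K)
    finally have "(sqrt (real (m j) + 1) * q ^ (\<Sum>i\<in>UNIV. m i)) * (C * \<rho>' ^ (\<Sum>i\<in>UNIV. m i))
        \<le> K * (C * \<rho>' ^ (\<Sum>i\<in>UNIV. m i))"
      using C \<rho>' by (intro mult_right_mono) auto
    then show ?thesis unfolding \<rho> power_mult_distrib by (simp add: mult_ac)
  qed
  \<comment> \<open>Annihilation evaluates the bound at one more quantum and gains a factor \<rho>;
    creation evaluates it at one fewer and loses one. The sum covers both.\<close>
  define L where "L = K * \<rho> + K / \<rho>"
  have L: "K * \<rho> \<le> L" "K / \<rho> \<le> L" using K(1) assms by (auto simp: L_def)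
  have L0: "0 \<le> L" using K(1) assms by (simp add: L_def)
  show ?thesis
  proof (rule that[OF L0])
    fix j C and f :: "'n fock" assume f: "geom_bound \<rho> C f"
    have C: "0 \<le> C" by (rule geom_bound_nonneg[OF f])
    have a: "cmod (annihilation j f m) \<le> L * C * \<rho>' ^ (\<Sum>i\<in>UNIV. m i)" for m
    proof -
      have "cmod (annihilation j f m) = sqrt (real (m j) + 1) * cmod (f (m(j := m j + 1)))"
        by (simp add: annihilation_def norm_mult)
      also have "\<dots> \<le> sqrt (real (m j) + 1) * (C * \<rho> ^ ((\<Sum>i\<in>UNIV. m i) + 1))"
        using geom_boundD[OF f, of "m(j := m j + 1)"] sum_fun_upd_UNIV[of m j "m j + 1"]
        by (intro mult_left_mono) auto
      also have "\<dots> = (sqrt (real (m j) + 1) * (C * \<rho> ^ (\<Sum>i\<in>UNIV. m i))) * \<rho>"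
        by simp
      also have "\<dots> \<le> (K * C * \<rho>' ^ (\<Sum>i\<in>UNIV. m i)) * \<rho>"
        using main[OF C] assms by (intro mult_right_mono) auto
      also have "\<dots> = (K * \<rho>) * (C * \<rho>' ^ (\<Sum>i\<in>UNIV. m i))" by simp
      also have "\<dots> \<le> L * (C * \<rho>' ^ (\<Sum>i\<in>UNIV. m i))"
        using L C \<rho>' by (intro mult_right_mono) auto
      finally show ?thesis by simp
    qed
    show "geom_bound \<rho>' (L * C) (annihilation j f)"
      unfolding geom_bound_def using a by blast
    have c: "cmod (creation j f m) \<le> L * C * \<rho>' ^ (\<Sum>i\<in>UNIV. m i)" for m
    proof (cases "m j = 0")
      case True
      then show ?thesis using L0 C \<rho>' by (simp add: creation_def)
    next
      case False
      then have "(\<Sum>i\<in>UNIV. m i) = (\<Sum>i\<in>UNIV. (m(j := m j - 1)) i) + 1"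
        using sum_fun_upd_UNIV[of m j "m j - 1"] by simp
      then have e: "\<rho> ^ (\<Sum>i\<in>UNIV. (m(j := m j - 1)) i) = \<rho> ^ (\<Sum>i\<in>UNIV. m i) / \<rho>"
        using assms by simp
      have "cmod (creation j f m) = sqrt (real (m j)) * cmod (f (m(j := m j - 1)))"
        by (simp add: creation_def norm_mult)
      also have "\<dots> \<le> sqrt (real (m j) + 1) * (C * \<rho> ^ (\<Sum>i\<in>UNIV. (m(j := m j - 1)) i))"
        by (intro mult_mono geom_boundD[OF f]) auto
      also have "\<dots> = (sqrt (real (m j) + 1) * (C * \<rho> ^ (\<Sum>i\<in>UNIV. m i))) / \<rho>"
        unfolding e by simp
      also have "\<dots> \<le> (K * C * \<rho>' ^ (\<Sum>i\<in>UNIV. m i)) / \<rho>"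
        using main[OF C] assms by (intro divide_right_mono) auto
      also have "\<dots> = (K / \<rho>) * (C * \<rho>' ^ (\<Sum>i\<in>UNIV. m i))" by simp
      also have "\<dots> \<le> L * (C * \<rho>' ^ (\<Sum>i\<in>UNIV. m i))"
        using L C \<rho>' by (intro mult_right_mono) auto
      finally show ?thesis by simp
    qed
    show "geom_bound \<rho>' (L * C) (creation j f)"
      unfolding geom_bound_def using c by blast
  qed
qed

lemma decaying_annihilation: "f \<in> decaying \<Longrightarrow> annihilation j f \<in> decaying"
  and decaying_creation: "f \<in> decaying \<Longrightarrow> creation j f \<in> decaying"
proof -
  have "annihilation j f \<in> decaying \<and> creation j f \<in> decaying" if "f \<in> decaying"
  proof -
    obtain \<rho> C where \<rho>: "0 < \<rho>" "\<rho> < 1" "geom_bound \<rho> C f"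
      using \<open>f \<in> decaying\<close> unfolding decaying_def by auto
    \<comment> \<open>The midpoint between \<rho> and 1 leaves room for the increase of the ratio
      while staying below 1.\<close>
    then have *: "\<rho> < (1 + \<rho>) / 2" "0 < (1 + \<rho>) / 2" "(1 + \<rho>) / 2 < 1" by auto
    obtain L where "geom_bound ((1 + \<rho>) / 2) (L * C) (annihilation j f)"
      "geom_bound ((1 + \<rho>) / 2) (L * C) (creation j f)"
      by (rule geom_bound_ladder[OF \<rho>(1) *(1)]) (use \<rho>(3) in blast)
    then show ?thesis using * unfolding decaying_def by blast
  qed
  then show "f \<in> decaying \<Longrightarrow> annihilation j f \<in> decaying" "f \<in> decaying \<Longrightarrow> creation j f \<in> decaying"
    by auto
qed

lemma finite_particle_decaying:
  fixes f :: "'n::finite fock"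
  assumes "f \<in> finite_particle"
  shows "f \<in> decaying"
proof -
  let ?S = "{m. f m \<noteq> 0}"
  \<comment> \<open>With ratio 1/2, these are the constants that each single amplitude requires;
    their finite sum serves all of them.\<close>
  let ?B = "\<lambda>m. cmod (f m) * 2 ^ (\<Sum>i\<in>UNIV. m i)"
  have fin: "finite ?S" using assms by (simp add: finite_particle_def)
  have "cmod (f m) \<le> (\<Sum>m\<in>?S. ?B m) * (1/2) ^ (\<Sum>i\<in>UNIV. m i)" for m
  proof (cases "m \<in> ?S")
    case True
    then have "?B m \<le> (\<Sum>m\<in>?S. ?B m)" using fin by (intro member_le_sum) auto
    then show ?thesis by (simp add: power_one_over field_simps)
  qed (auto intro!: mult_nonneg_nonneg sum_nonneg)
  then have "geom_bound (1/2) (\<Sum>m\<in>?S. ?B m) f" by (simp add: geom_bound_def)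
  then show ?thesis
    unfolding decaying_def mem_Collect_eq
    by (intro exI[of _ "1/2"] exI[of _ "\<Sum>m\<in>?S. ?B m"]) auto
qed

section \<open>Adjointness and commutation relations of the ladder operators\<close>

lemma fock_inner_creation_right: "fock_inner f (creation j h) = fock_inner (annihilation j f) h"
proof -
  let ?up = "\<lambda>m::'a \<Rightarrow> nat. m(j := m j + 1)"
  let ?F = "\<lambda>m. cnj (f m) * creation j h m"
  \<comment> \<open>Adding one quantum in mode \<open>j\<close> is an injective change of the
    summation index. The patterns that it misses have \<open>m j = 0\<close>, where the factor in
    \<open>creation\<close> vanishes; on its range the two sums agree term by term.\<close>
  have inj: "inj ?up"
  proof (rule injI)
    fix m n :: "'a \<Rightarrow> nat"
    assume e: "?up m = ?up n"
    show "m = n"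
    proof
      fix i show "m i = n i" using fun_cong[OF e, of i] by (cases "i = j") auto
    qed
  qed
  have out: "?F m = 0" if "m \<notin> range ?up" for m
  proof -
    have "m j = 0"
    proof (rule ccontr)
      assume "m j \<noteq> 0"
      then have "m = ?up (m(j := m j - 1))" by auto
      with that show False by blast
    qed
    then show ?thesis by (simp add: creation_def)
  qed
  have "fock_inner f (creation j h) = infsum ?F (range ?up)"
    unfolding fock_inner_def by (rule infsum_cong_neutral) (use out in auto)
  also have "\<dots> = infsum (?F \<circ> ?up) UNIV"
    by (rule infsum_reindex[OF inj])
  also have "\<dots> = fock_inner (annihilation j f) h"
    unfolding fock_inner_def
    by (intro infsum_cong) (simp add: annihilation_def creation_def)
  finally show ?thesis .
qed

lemma fock_inner_annihilation_right:
  "fock_inner f (annihilation j h) = fock_inner (creation j f) h"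
  by (metis fock_inner_commute fock_inner_creation_right)

lemma annihilation_diff: "annihilation j (\<lambda>m. f m - g m) = (\<lambda>m. annihilation j f m - annihilation j g m)"
  by (auto simp: annihilation_def algebra_simps)

lemma creation_diff: "creation j (\<lambda>m. f m - g m) = (\<lambda>m. creation j f m - creation j g m)"
  and creation_scale: "creation j (\<lambda>m. c * f m) = (\<lambda>m. c * creation j f m)"
  by (auto simp: creation_def algebra_simps)

text \<open>The canonical commutation relation: the two orders multiply the amplitude by
  \<open>m j + 1\<close> and by \<open>m j\<close>.\<close>

lemma annihilation_creation_same:
  "annihilation j (creation j f) = (\<lambda>m. creation j (annihilation j f) m + f m)"
proof
  fix m
  have 1: "annihilation j (creation j f) m = of_real (real (m j) + 1) * f m"
    unfolding annihilation_def creation_def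
    by (simp add: mult.assoc[symmetric] of_real_mult[symmetric] add.commute del: of_real_mult of_real_add)
  have "creation j (annihilation j f) m = of_real (real (m j)) * f m"
  proof (cases "m j = 0")
    case False
    then have "real (m j - 1) + 1 = real (m j)" by simp
    with False show ?thesis unfolding annihilation_def creation_def
      by (simp add: mult.assoc[symmetric] of_real_mult[symmetric] del: of_real_mult)
  qed (simp add: creation_def)
  with 1 show "annihilation j (creation j f) m = creation j (annihilation j f) m + f m"
    by (simp add: distrib_right)
qed

lemma annihilation_creation_other:
  "j \<noteq> k \<Longrightarrow> annihilation j (creation k f) = creation k (annihilation j f)"
  by (auto simp: annihilation_def creation_def fun_upd_twist mult_ac)

lemma creation_commute: "creation j (creation k f) = creation k (creation j f)"
  by (cases "j = k") (auto simp: creation_def fun_upd_twist mult_ac)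

section \<open>The squeezing generator on decaying vectors\<close>

lemma squeeze_gen_diff:
  "squeeze_gen s j (\<lambda>m. f m - g m) = (\<lambda>m. squeeze_gen s j f m - squeeze_gen s j g m)"
  by (auto simp: squeeze_gen_def annihilation_diff creation_diff algebra_simps)

lemma decaying_squeeze_gen: "f \<in> decaying \<Longrightarrow> squeeze_gen s j f \<in> decaying"
  unfolding squeeze_gen_def
  by (intro decaying_scale decaying_diff decaying_annihilation decaying_creation)

text \<open>The squares of annihilation and creation are adjoint to each other, so their
  expectations are complex conjugates. Their difference is purely imaginary, and the prefactor is
  real.\<close>

lemma squeeze_gen_skew:
  assumes "f \<in> decaying"
  shows "Re (fock_inner f (squeeze_gen s j f)) = 0"
proof -
  let ?a = "annihilation j (annihilation j f)" and ?c = "creation j (creation j f)"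
  have "fock_inner f (squeeze_gen s j f) = of_real (s / 2) * (fock_inner f ?a - fock_inner f ?c)"
    unfolding squeeze_gen_def fock_inner_scale_right
    using assms by (subst fock_inner_diff_right)
      (auto intro!: decaying_fock_space decaying_annihilation decaying_creation)
  moreover have "fock_inner f ?c = cnj (fock_inner f ?a)"
    by (metis fock_inner_commute fock_inner_creation_right)
  ultimately show ?thesis by (simp only: Re_complex_of_real times_complex.sel minus_complex.sel
      Im_complex_of_real cnj.sel) simp
qed

text \<open>Two ladder steps, one from \<rho> to the midpoint \<sigma> and one from \<sigma> to
  \<rho>'. The two summands cancel the 1/2 in the prefactor, leaving the modulus of
  \<open>s\<close>.\<close>

lemma geom_bound_squeeze_gen:
  assumes "0 < \<rho>" "\<rho> < \<rho>'"
  obtains L where "0 \<le> L"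
    "\<And>C f. geom_bound \<rho> C (f::'n::finite fock) \<Longrightarrow> geom_bound \<rho>' (L * C) (squeeze_gen s j f)"
proof -
  define \<sigma> where "\<sigma> = (\<rho> + \<rho>') / 2"
  have \<sigma>: "\<rho> < \<sigma>" "\<sigma> < \<rho>'" "0 < \<sigma>" using assms by (auto simp: \<sigma>_def)
  obtain L1 where L1: "0 \<le> L1"
    "\<And>j C f. geom_bound \<rho> C (f::'n fock) \<Longrightarrow> geom_bound \<sigma> (L1 * C) (annihilation j f)"
    "\<And>j C f. geom_bound \<rho> C (f::'n fock) \<Longrightarrow> geom_bound \<sigma> (L1 * C) (creation j f)"
    by (rule geom_bound_ladder[OF assms(1) \<sigma>(1), where ?'n = 'n]) blast
  obtain L2 where L2: "0 \<le> L2"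
    "\<And>j C f. geom_bound \<sigma> C (f::'n fock) \<Longrightarrow> geom_bound \<rho>' (L2 * C) (annihilation j f)"
    "\<And>j C f. geom_bound \<sigma> C (f::'n fock) \<Longrightarrow> geom_bound \<rho>' (L2 * C) (creation j f)"
    by (rule geom_bound_ladder[OF \<sigma>(3) \<sigma>(2), where ?'n = 'n]) blast
  show ?thesis
  proof (rule that[of "\<bar>s\<bar> * (L2 * L1)"])
    show "0 \<le> \<bar>s\<bar> * (L2 * L1)" using L1(1) L2(1) by simp
    fix C and f :: "'n fock" assume f: "geom_bound \<rho> C f"
    have "geom_bound \<rho>' (cmod (of_real (s / 2)) * (L2 * (L1 * C) + cmod (-1) * (L2 * (L1 * C))))
      (\<lambda>m. of_real (s / 2) * (annihilation j (annihilation j f) m + (-1) * creation j (creation j f) m))"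
      by (intro geom_bound_scale geom_bound_add L1 L2 f)
    then show "geom_bound \<rho>' (\<bar>s\<bar> * (L2 * L1) * C) (squeeze_gen s j f)"
      unfolding squeeze_gen_def by (simp add: norm_divide mult_ac)
  qed
qed

text \<open>Truncation to at most \<open>k\<close> quanta in total gives the approximating
  finite-particle vectors. The error lives above \<open>k\<close> quanta, where splitting \<rho> as
  \<open>\<rho>' * q\<close> yields a factor \<open>q ^ k\<close> and still leaves decay with ratio
  \<rho>'. The generator keeps that factor, so both limits in the closure follow.\<close>

lemma decaying_op_closure:
  fixes f :: "'n::finite fock"
  assumes f: "f \<in> decaying"
  shows "(f, squeeze_gen s j f) \<in> op_closure (squeeze_gen s j)"
proof -
  let ?A = "squeeze_gen s j"
  obtain \<rho> C where \<rho>: "0 < \<rho>" "\<rho> < 1" and C: "geom_bound \<rho> C f"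
    using f unfolding decaying_def by auto
  define \<rho>' where "\<rho>' = (1 + \<rho>) / 2"
  define \<rho>'' where "\<rho>'' = (1 + \<rho>') / 2"
  have \<rho>': "\<rho> < \<rho>'" "0 < \<rho>'" "\<rho>' < 1" and \<rho>'': "\<rho>' < \<rho>''" "0 < \<rho>''" "\<rho>'' < 1"
    using \<rho> by (simp_all add: \<rho>''_def \<rho>'_def field_simps)
  obtain L where L: "0 \<le> L" "\<And>C f. geom_bound \<rho>' C (f::'n fock) \<Longrightarrow> geom_bound \<rho>'' (L * C) (?A f)"
    by (rule geom_bound_squeeze_gen[OF \<rho>'(2) \<rho>''(1), where ?'n = 'n and s = s and j = j]) blast
  define q where "q = \<rho> / \<rho>'"
  have q: "0 < q" "q < 1" and \<rho>q: "\<rho> = \<rho>' * q" using \<rho> \<rho>' by (auto simp: q_def)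
  define g where "g k = (\<lambda>m. if (\<Sum>i\<in>UNIV. m i) \<le> k then f m else 0)" for k :: nat
  have C0: "0 \<le> C" by (rule geom_bound_nonneg[OF C])
  have bd: "geom_bound \<rho>' (C * q ^ k) (\<lambda>m. g k m - f m)" for k
    unfolding geom_bound_def
  proof
    fix m
    show "cmod (g k m - f m) \<le> C * q ^ k * \<rho>' ^ (\<Sum>i\<in>UNIV. m i)"
    proof (cases "(\<Sum>i\<in>UNIV. m i) \<le> k")
      case True
      then show ?thesis using C0 q \<rho>' by (simp add: g_def)
    next
      case False
      then have "cmod (g k m - f m) \<le> C * \<rho> ^ (\<Sum>i\<in>UNIV. m i)"
        using geom_boundD[OF C, of m] by (simp add: g_def)
      also have "\<dots> = C * q ^ (\<Sum>i\<in>UNIV. m i) * \<rho>' ^ (\<Sum>i\<in>UNIV. m i)"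
        by (simp add: \<rho>q power_mult_distrib)
      also have "\<dots> \<le> C * q ^ k * \<rho>' ^ (\<Sum>i\<in>UNIV. m i)"
        using False C0 q \<rho>' by (intro mult_right_mono mult_left_mono power_decreasing) auto
      finally show ?thesis .
    qed
  qed
  have fin: "g k \<in> finite_particle" for k
  proof -
    have "{m. g k m \<noteq> 0} \<subseteq> PiE UNIV (\<lambda>_::'n. {..k})"
    proof
      fix m assume "m \<in> {m. g k m \<noteq> 0}"
      then have s: "(\<Sum>i\<in>UNIV. m i) \<le> k" by (auto simp: g_def split: if_splits)
      have "m i \<le> (\<Sum>i\<in>UNIV. m i)" for i by (rule member_le_sum) auto
      with s have "m i \<le> k" for i using le_trans by blast
      then show "m \<in> PiE UNIV (\<lambda>_::'n. {..k})" by auto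
    qed
    then show ?thesis unfolding finite_particle_def mem_Collect_eq
      by (rule finite_subset) (auto intro: finite_PiE)
  qed
  have lim: "(\<lambda>k. K * (C * q ^ k) * K') \<longlonglongrightarrow> 0" for K K' :: real
    using q by (auto intro!: tendsto_mult_left_zero tendsto_mult_right_zero LIMSEQ_power_zero)
  have "(\<lambda>k. fock_norm (\<lambda>m. g k m - f m)) \<longlonglongrightarrow> 0"
    using lim[of 1]
    by (intro tendsto_sandwich[OF _ _ tendsto_const lim[of 1]] always_eventually allI)
      (use geom_bound_fock_norm(2)[OF bd \<rho>'(2,3)] in auto)
  moreover have "(\<lambda>k. fock_norm (\<lambda>m. ?A (g k) m - ?A f m)) \<longlonglongrightarrow> 0"
    using geom_bound_fock_norm(2)[OF L(2)[OF bd] \<rho>''(2,3)]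
    by (intro tendsto_sandwich[OF _ _ tendsto_const lim[of L]] always_eventually allI)
      (auto simp: squeeze_gen_diff)
  ultimately show ?thesis
    unfolding op_closure_def
    using f fin finite_particle_decaying[OF fin]
    by (auto intro!: decaying_fock_space decaying_squeeze_gen exI[of _ g])
qed

section \<open>Evolution curves\<close>

text \<open>Stated with a scalar \<open>c\<close> to serve two purposes: \<open>c = -1\<close> for
  differences of vectors, and a real \<open>c\<close> for the Pythagorean identity.\<close>

lemma fock_norm_add_diff_le:
  assumes "f \<in> fock_space" "f' \<in> fock_space" "g \<in> fock_space" "g' \<in> fock_space"
  shows "fock_norm (\<lambda>m. (f m + c * g m) - (f' m + c * g' m))
    \<le> fock_norm (\<lambda>m. f m - f' m) + cmod c * fock_norm (\<lambda>m. g m - g' m)"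
proof -
  have "(\<lambda>m. (f m + c * g m) - (f' m + c * g' m)) = (\<lambda>m. (f m - f' m) + c * (g m - g' m))"
    by (simp add: algebra_simps)
  then show ?thesis
    using fock_norm_triangle[OF fock_space_diff[OF assms(1,2)]
        fock_space_scale[OF fock_space_diff[OF assms(3,4)], of c]]
    by (simp add: fock_norm_scale)
qed

lemma fock_norm_tendsto:
  assumes "\<And>k. g k \<in> fock_space" "f \<in> fock_space" "(\<lambda>k. fock_norm (\<lambda>m. g k m - f m)) \<longlonglongrightarrow> 0"
  shows "(\<lambda>k. fock_norm (g k)) \<longlonglongrightarrow> fock_norm f"
proof -
  have "(\<lambda>k. fock_norm (g k) - fock_norm f) \<longlonglongrightarrow> 0"
    by (rule Lim_null_comparison[OF _ assms(3)])
      (auto intro!: always_eventually fock_norm_diff_le assms)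
  then show ?thesis by (simp add: LIM_zero_iff)
qed

text \<open>Skewness of the generator says \<open>Re \<langle>f, A f\<rangle> = 0\<close>; in this Pythagorean form, which involves norms only,
  it passes to the closure by the triangle inequality.\<close>

lemma op_closure_pythagoras:
  fixes f h :: "'n::finite fock"
  assumes cl: "(f, h) \<in> op_closure (squeeze_gen s j)"
  shows "(fock_norm (\<lambda>m. f m + of_real e * h m))\<^sup>2 = (fock_norm f)\<^sup>2 + e\<^sup>2 * (fock_norm h)\<^sup>2"
proof -
  let ?A = "squeeze_gen s j"
  obtain g where fh: "f \<in> fock_space" "h \<in> fock_space"
    and g: "\<And>k. g k \<in> finite_particle" "\<And>k. ?A (g k) \<in> fock_space"
    and lim: "(\<lambda>k. fock_norm (\<lambda>m. g k m - f m)) \<longlonglongrightarrow> 0"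
      "(\<lambda>k. fock_norm (\<lambda>m. ?A (g k) m - h m)) \<longlonglongrightarrow> 0"
    using cl unfolding op_closure_def by auto
  have gd: "g k \<in> decaying" for k using g(1) by (rule finite_particle_decaying)
  then have gs: "g k \<in> fock_space" for k by (rule decaying_fock_space)
  have eq: "(fock_norm (\<lambda>m. g k m + of_real e * ?A (g k) m))\<^sup>2
      = (fock_norm (g k))\<^sup>2 + e\<^sup>2 * (fock_norm (?A (g k)))\<^sup>2" for k
    using fock_norm_add_sq[OF gs fock_space_scale[OF g(2)], of k "of_real e" k]
      squeeze_gen_skew[OF gd, of k s j]
    by (simp add: fock_norm_scale fock_inner_scale_right power_mult_distrib)
  have "(\<lambda>k. fock_norm (\<lambda>m. g k m + of_real e * ?A (g k) m)) \<longlonglongrightarrow> fock_norm (\<lambda>m. f m + of_real e * h m)"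
  proof (rule fock_norm_tendsto)
    have "(\<lambda>k. fock_norm (\<lambda>m. g k m - f m) + cmod (of_real e) * fock_norm (\<lambda>m. ?A (g k) m - h m))
        \<longlonglongrightarrow> 0 + cmod (of_real e) * 0"
      by (intro tendsto_intros lim)
    then have *: "(\<lambda>k. fock_norm (\<lambda>m. g k m - f m) + cmod (of_real e) * fock_norm (\<lambda>m. ?A (g k) m - h m)) \<longlonglongrightarrow> 0"
      by simp
    show "(\<lambda>k. fock_norm (\<lambda>m. (g k m + of_real e * ?A (g k) m) - (f m + of_real e * h m))) \<longlonglongrightarrow> 0"
      by (rule Lim_null_comparison[OF _ *])
        (simp add: fock_norm_add_diff_le gs g fh del: norm_of_real)
  qed (auto intro!: fock_space_add fock_space_scale fh gs g)
  then have "(\<lambda>k. (fock_norm (g k))\<^sup>2 + e\<^sup>2 * (fock_norm (?A (g k)))\<^sup>2)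
      \<longlonglongrightarrow> (fock_norm (\<lambda>m. f m + of_real e * h m))\<^sup>2"
    unfolding eq[symmetric] by (rule tendsto_power)
  moreover have "(\<lambda>k. (fock_norm (g k))\<^sup>2 + e\<^sup>2 * (fock_norm (?A (g k)))\<^sup>2)
      \<longlonglongrightarrow> (fock_norm f)\<^sup>2 + e\<^sup>2 * (fock_norm h)\<^sup>2"
    by (intro tendsto_add tendsto_mult tendsto_power tendsto_const
        fock_norm_tendsto[OF gs fh(1) lim(1)] fock_norm_tendsto[OF g(2) fh(2) lim(2)])
  ultimately show ?thesis by (rule LIMSEQ_unique)
qed

lemma op_closure_diff:
  fixes f h f' h' :: "'n::finite fock"
  assumes "(f, h) \<in> op_closure (squeeze_gen s j)" "(f', h') \<in> op_closure (squeeze_gen s j)"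
  shows "((\<lambda>m. f m - f' m), (\<lambda>m. h m - h' m)) \<in> op_closure (squeeze_gen s j)"
proof -
  let ?A = "squeeze_gen s j"
  obtain g where fh: "f \<in> fock_space" "h \<in> fock_space"
    and g: "\<And>k. g k \<in> finite_particle" "\<And>k. ?A (g k) \<in> fock_space"
    and lim: "(\<lambda>k. fock_norm (\<lambda>m. g k m - f m)) \<longlonglongrightarrow> 0"
      "(\<lambda>k. fock_norm (\<lambda>m. ?A (g k) m - h m)) \<longlonglongrightarrow> 0"
    using assms(1) unfolding op_closure_def by auto
  obtain g' where fh': "f' \<in> fock_space" "h' \<in> fock_space"
    and g': "\<And>k. g' k \<in> finite_particle" "\<And>k. ?A (g' k) \<in> fock_space"
    and lim': "(\<lambda>k. fock_norm (\<lambda>m. g' k m - f' m)) \<longlonglongrightarrow> 0"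
      "(\<lambda>k. fock_norm (\<lambda>m. ?A (g' k) m - h' m)) \<longlonglongrightarrow> 0"
    using assms(2) unfolding op_closure_def by auto
  have gs: "g k \<in> fock_space" "g' k \<in> fock_space" for k
    by (auto intro!: decaying_fock_space finite_particle_decaying g g')
  have fin: "(\<lambda>m. g k m - g' k m) \<in> finite_particle" for k
    using g(1)[of k] g'(1)[of k] unfolding finite_particle_def mem_Collect_eq
    by (rule_tac finite_subset[of _ "{m. g k m \<noteq> 0} \<union> {m. g' k m \<noteq> 0}"]) auto
  have "(\<lambda>k. fock_norm (\<lambda>m. (g k m - g' k m) - (f m - f' m))) \<longlonglongrightarrow> 0"
    using fock_norm_add_diff_le[OF gs(1) fh(1) gs(2) fh'(1), of _ "-1"]
    by (intro Lim_null_comparison[OF _ tendsto_add_zero[OF lim(1) lim'(1)]]) auto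
  moreover have "(\<lambda>k. fock_norm (\<lambda>m. ?A (\<lambda>m. g k m - g' k m) m - (h m - h' m))) \<longlonglongrightarrow> 0"
    using fock_norm_add_diff_le[OF g(2) fh(2) g'(2) fh'(2), of _ "-1"]
    by (intro Lim_null_comparison[OF _ tendsto_add_zero[OF lim(2) lim'(2)]]) (auto simp: squeeze_gen_diff)
  ultimately show ?thesis
    unfolding op_closure_def using fin
    by (auto intro!: fock_space_diff fh fh' exI[of _ "\<lambda>k m. g k m - g' k m"]
        simp: squeeze_gen_diff g g')
qed

lemma evolution_curve_fock_space:
  assumes "evolution_curve A u"
  shows "u t \<in> fock_space"
  using assms unfolding evolution_curve_def op_closure_def by blast

text \<open>Linearity of the equation, which reduces uniqueness to conservation of the norm.\<close>

lemma evolution_curve_diff: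
  fixes u v :: "real \<Rightarrow> 'n::finite fock"
  assumes u: "evolution_curve (squeeze_gen s j) u" and v: "evolution_curve (squeeze_gen s j) v"
  shows "evolution_curve (squeeze_gen s j) (\<lambda>t m. u t m - v t m)"
  unfolding evolution_curve_def
proof
  fix t
  obtain h where h: "(u t, h) \<in> op_closure (squeeze_gen s j)"
    "((\<lambda>x. fock_norm (\<lambda>m. (u x m - u t m) / of_real (x - t) - h m)) \<longlongrightarrow> 0) (at t)"
    using u unfolding evolution_curve_def by blast
  obtain h' where h': "(v t, h') \<in> op_closure (squeeze_gen s j)"
    "((\<lambda>x. fock_norm (\<lambda>m. (v x m - v t m) / of_real (x - t) - h' m)) \<longlongrightarrow> 0) (at t)"
    using v unfolding evolution_curve_def by blast
  have hs: "h \<in> fock_space" "h' \<in> fock_space" using h(1) h'(1) by (auto simp: op_closure_def)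
  have qs: "(\<lambda>m. (w x m - w t m) / of_real (x - t)) \<in> fock_space"
    if "evolution_curve (squeeze_gen s j) w" for w x
    using fock_space_scale[OF fock_space_diff[OF evolution_curve_fock_space[OF that]
          evolution_curve_fock_space[OF that]], of "1 / of_real (x - t)" x t] by simp
  have eq: "(\<lambda>m. (u x m - v x m - (u t m - v t m)) / of_real (x - t) - (h m - h' m))
    = (\<lambda>m. ((u x m - u t m) / of_real (x - t) - (v x m - v t m) / of_real (x - t)) - (h m - h' m))" for x
  proof
    fix m
    have "u x m - v x m - (u t m - v t m) = (u x m - u t m) - (v x m - v t m)" by simp
    then show "(u x m - v x m - (u t m - v t m)) / of_real (x - t) - (h m - h' m)
      = ((u x m - u t m) / of_real (x - t) - (v x m - v t m) / of_real (x - t)) - (h m - h' m)"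
      by (simp only: diff_divide_distrib)
  qed
  have "fock_norm (\<lambda>m. (u x m - v x m - (u t m - v t m)) / of_real (x - t) - (h m - h' m))
    \<le> fock_norm (\<lambda>m. (u x m - u t m) / of_real (x - t) - h m)
     + fock_norm (\<lambda>m. (v x m - v t m) / of_real (x - t) - h' m)" for x
    using fock_norm_add_diff_le[OF qs[OF u] hs(1) qs[OF v] hs(2), of x "-1" x]
    unfolding eq by (simp only: mult_minus1 add_uminus_conv_diff norm_minus_cancel norm_one mult_1)
  then have "((\<lambda>x. fock_norm (\<lambda>m. (u x m - v x m - (u t m - v t m)) / of_real (x - t) - (h m - h' m))) \<longlongrightarrow> 0) (at t)"
    by (intro Lim_null_comparison[OF _ tendsto_add_zero[OF h(2) h'(2)]]) auto
  with op_closure_diff[OF h(1) h'(1)]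
  show "\<exists>h. ((\<lambda>m. u t m - v t m), h) \<in> op_closure (squeeze_gen s j) \<and>
    ((\<lambda>x. fock_norm (\<lambda>m. (u x m - v x m - (u t m - v t m)) / of_real (x - t) - h m)) \<longlongrightarrow> 0) (at t)"
    by blast
qed

text \<open>The squared norm has derivative zero everywhere. Near \<open>t\<close> the curve is
  tangent to the line \<open>u t + (x - t) h\<close>, and by \<open>op_closure_pythagoras\<close>
  the squared norm along that line changes only to second order in \<open>x - t\<close>.\<close>

lemma evolution_curve_norm:
  fixes u :: "real \<Rightarrow> 'n::finite fock"
  assumes u: "evolution_curve (squeeze_gen s j) u"
  shows "fock_norm (u t) = fock_norm (u t')"
proof -
  have "((\<lambda>x. (fock_norm (u x))\<^sup>2) has_field_derivative 0) (at t)" for t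
  proof -
    obtain h where h: "(u t, h) \<in> op_closure (squeeze_gen s j)"
      "((\<lambda>x. fock_norm (\<lambda>m. (u x m - u t m) / of_real (x - t) - h m)) \<longlongrightarrow> 0) (at t)"
      using u unfolding evolution_curve_def by blast
    have hs: "h \<in> fock_space" using h(1) by (auto simp: op_closure_def)
    have us: "u x \<in> fock_space" for x by (rule evolution_curve_fock_space[OF u])
    define e where "e x = fock_norm (\<lambda>m. (u x m - u t m) / of_real (x - t) - h m)" for x
    define n where "n x = fock_norm (u x)" for x
    \<comment> \<open>\<open>N\<close> is the norm on the tangent line, while \<open>e\<close> is
      the error of the difference quotient, which tends to 0.\<close>
    define N where "N x = fock_norm (\<lambda>m. u t m + of_real (x - t) * h m)" for x
    define H where "H = fock_norm h"
    have bound: "\<bar>((n x)\<^sup>2 - (n t)\<^sup>2) / (x - t)\<bar>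
        \<le> e x * (2 * (n t + \<bar>x - t\<bar> * H) + \<bar>x - t\<bar> * e x) + \<bar>x - t\<bar> * H\<^sup>2" if "x \<noteq> t" for x
    proof -
      define d where "d = \<bar>x - t\<bar>"
      have d: "0 < d" using that by (simp add: d_def)
      have N_le: "N x \<le> n t + d * H"
        using fock_norm_triangle[OF us[of t] fock_space_scale[OF hs, of "of_real (x - t)"]]
        unfolding N_def n_def H_def d_def fock_norm_scale by (simp flip: of_real_diff)
      have pyth: "(N x)\<^sup>2 = (n t)\<^sup>2 + d\<^sup>2 * H\<^sup>2"
        unfolding N_def n_def H_def d_def op_closure_pythagoras[OF h(1)] by simp
      have "\<bar>n x - N x\<bar> \<le> fock_norm (\<lambda>m. u x m - (u t m + of_real (x - t) * h m))"
        unfolding n_def N_def by (intro fock_norm_diff_le fock_space_add fock_space_scale us hs)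
      also have "(\<lambda>m. u x m - (u t m + of_real (x - t) * h m))
          = (\<lambda>m. of_real (x - t) * ((u x m - u t m) / of_real (x - t) - h m))"
        proof -
          have "complex_of_real (x - t) \<noteq> 0" using that by simp
          then show ?thesis by (simp add: right_diff_distrib diff_divide_distrib algebra_simps del: of_real_diff)
        qed
      also have "fock_norm \<dots> = d * e x"
        unfolding fock_norm_scale e_def d_def norm_of_real ..
      finally have dn: "\<bar>n x - N x\<bar> \<le> d * e x" .
      have nn: "0 \<le> n x" "0 \<le> N x" "0 \<le> e x" by (auto simp: n_def N_def e_def)
      \<comment> \<open>The change splits into curve against tangent line, a difference of squares
        whose first factor is at most \<open>d * e x\<close>, and tangent line against
        \<open>u t\<close>, which is \<open>d^2 H^2\<close> by \<open>pyth\<close>. Both are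
        \<open>o(d)\<close>.\<close>
      have "(n x)\<^sup>2 - (n t)\<^sup>2 = (n x - N x) * (n x + N x) + d\<^sup>2 * H\<^sup>2"
        using pyth by (simp add: power2_eq_square algebra_simps)
      then have "\<bar>(n x)\<^sup>2 - (n t)\<^sup>2\<bar> \<le> \<bar>n x - N x\<bar> * (n x + N x) + d\<^sup>2 * H\<^sup>2"
        using nn abs_triangle_ineq[of "(n x - N x) * (n x + N x)" "d\<^sup>2 * H\<^sup>2"] by (simp add: abs_mult)
      also have "\<dots> \<le> (d * e x) * (2 * (n t + d * H) + d * e x) + d\<^sup>2 * H\<^sup>2"
      proof -
        have "n x + N x \<le> 2 * (n t + d * H) + d * e x"
            using abs_le_D1[OF dn] N_le by (simp add: algebra_simps)
        then show ?thesis using dn nn d by (intro add_right_mono mult_mono) auto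
      qed
      also have "\<dots> = d * (e x * (2 * (n t + d * H) + d * e x) + d * H\<^sup>2)"
        by (simp add: power2_eq_square algebra_simps)
      finally show ?thesis
        using d by (simp add: d_def[symmetric] abs_divide pos_divide_le_eq mult.commute)
    qed
    have e0: "(e \<longlongrightarrow> 0) (at t)" using h(2) by (simp add: e_def[abs_def])
    have "((\<lambda>x. e x * (2 * (n t + \<bar>x - t\<bar> * H) + \<bar>x - t\<bar> * e x) + \<bar>x - t\<bar> * H\<^sup>2) \<longlongrightarrow>
        0 * (2 * (n t + \<bar>t - t\<bar> * H) + \<bar>t - t\<bar> * 0) + \<bar>t - t\<bar> * H\<^sup>2) (at t)"
      by (intro tendsto_intros e0)
    then have lim: "((\<lambda>x. e x * (2 * (n t + \<bar>x - t\<bar> * H) + \<bar>x - t\<bar> * e x) + \<bar>x - t\<bar> * H\<^sup>2) \<longlongrightarrow> 0) (at t)"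
      by simp
    have "\<forall>\<^sub>F x in at t. norm (((n x)\<^sup>2 - (n t)\<^sup>2) / (x - t))
        \<le> e x * (2 * (n t + \<bar>x - t\<bar> * H) + \<bar>x - t\<bar> * e x) + \<bar>x - t\<bar> * H\<^sup>2"
      unfolding eventually_at_filter real_norm_def using bound by (intro always_eventually) blast
    from Lim_null_comparison[OF this lim]
    have "((\<lambda>x. ((n x)\<^sup>2 - (n t)\<^sup>2) / (x - t)) \<longlongrightarrow> 0) (at t)" .
    then show ?thesis unfolding has_field_derivative_iff n_def .
  qed
  then have "(fock_norm (u t))\<^sup>2 = (fock_norm (u t'))\<^sup>2"
    using DERIV_isconst_all by blast
  then show ?thesis by (simp add: power2_eq_iff_nonneg)
qed

text \<open>The difference of two solutions is a solution of constant norm, and it vanishes at time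
  0.\<close>

lemma evolution_curve_unique:
  fixes u v :: "real \<Rightarrow> 'n::finite fock"
  assumes "evolution_curve (squeeze_gen s j) u" "evolution_curve (squeeze_gen s j) v" "u 0 = v 0"
  shows "u t = v t"
proof -
  note w = evolution_curve_diff[OF assms(1,2)]
  have "fock_norm (\<lambda>m. u t m - v t m) = fock_norm (\<lambda>m. u 0 m - v 0 m)"
    using evolution_curve_norm[OF w, of t 0] by simp
  also have "\<dots> = 0" using assms(3) by (simp add: fock_norm_def)
  finally have "(\<lambda>m. u t m - v t m) = (\<lambda>_. 0)"
    using fock_norm_eq_0_imp evolution_curve_fock_space[OF w] by blast
  then show ?thesis by (auto simp: fun_eq_iff)
qed

text \<open>Uniqueness of evolution curves justifies the definite description in
  \<open>op_exp\<close>, so exhibiting any solution evaluates the exponential.\<close>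

lemma op_exp_eq:
  fixes u :: "real \<Rightarrow> 'n::finite fock"
  assumes "evolution_curve (squeeze_gen s j) u"
  shows "op_exp (squeeze_gen s j) (u 0) = u 1"
  unfolding op_exp_def
proof (rule the_equality)
  show "\<exists>v. evolution_curve (squeeze_gen s j) v \<and> v 0 = u 0 \<and> v 1 = u 1"
    using assms by blast
  fix g
  assume "\<exists>v. evolution_curve (squeeze_gen s j) v \<and> v 0 = u 0 \<and> v 1 = g"
  then obtain v where v: "evolution_curve (squeeze_gen s j) v" "v 0 = u 0" "v 1 = g" by blast
  show "g = u 1" using evolution_curve_unique[OF v(1) assms v(2), of 1] v(3) by simp
qed

text \<open>Each coefficient of the image involves only finitely many coefficients of the argument,
  so the generator commutes with coefficientwise differentiation.\<close>

lemma has_vector_derivative_squeeze_gen: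
  assumes "\<And>m. ((\<lambda>t. u t m) has_vector_derivative v m) (at t)"
  shows "((\<lambda>t. squeeze_gen s j (u t) m) has_vector_derivative squeeze_gen s j v m) (at t)"
  unfolding squeeze_gen_def annihilation_def creation_def
  by (rule has_vector_derivative_mult_right[OF has_vector_derivative_diff[OF
        has_vector_derivative_mult_right[OF has_vector_derivative_mult_right[OF assms]]
        has_vector_derivative_mult_right[OF has_vector_derivative_mult_right[OF assms]]]])

text \<open>The bound makes the second derivative \<open>A (A (u t))\<close> uniformly square-summable, so that
  coefficientwise differentiability upgrades to differentiability in norm.\<close>

lemma evolution_curveI:
  fixes u :: "real \<Rightarrow> 'n::finite fock"
  assumes der: "\<And>t m. ((\<lambda>t. u t m) has_vector_derivative squeeze_gen s j (u t) m) (at t)"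
    and bd: "\<And>t. \<exists>\<rho> C. 0 < \<rho> \<and> \<rho> < 1 \<and> (\<forall>x. \<bar>x - t\<bar> \<le> 1 \<longrightarrow> geom_bound \<rho> C (u x))"
  shows "evolution_curve (squeeze_gen s j) u"
  unfolding evolution_curve_def
proof
  fix t
  let ?A = "squeeze_gen s j"
  obtain \<rho> C where \<rho>: "0 < \<rho>" "\<rho> < 1" and ub: "\<And>x. \<bar>x - t\<bar> \<le> 1 \<Longrightarrow> geom_bound \<rho> C (u x)"
    using bd by blast
  define \<rho>' where "\<rho>' = (1 + \<rho>) / 2"
  define \<rho>'' where "\<rho>'' = (1 + \<rho>') / 2"
  have \<rho>': "\<rho> < \<rho>'" "0 < \<rho>'" "\<rho>' < 1" and \<rho>'': "\<rho>' < \<rho>''" "0 < \<rho>''" "\<rho>'' < 1"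
    using \<rho> by (simp_all add: \<rho>''_def \<rho>'_def field_simps)
  obtain L1 where L1: "\<And>C f. geom_bound \<rho> C (f::'n fock) \<Longrightarrow> geom_bound \<rho>' (L1 * C) (?A f)"
    by (rule geom_bound_squeeze_gen[OF \<rho>(1) \<rho>'(1), where ?'n = 'n and s = s and j = j]) blast
  obtain L2 where L2: "\<And>C f. geom_bound \<rho>' C (f::'n fock) \<Longrightarrow> geom_bound \<rho>'' (L2 * C) (?A f)"
    by (rule geom_bound_squeeze_gen[OF \<rho>'(2) \<rho>''(1), where ?'n = 'n and s = s and j = j]) blast
  define K where "K = L2 * (L1 * C)"
  have AA: "geom_bound \<rho>'' K (?A (?A (u x)))" if "\<bar>x - t\<bar> \<le> 1" for x
    unfolding K_def by (intro L1 L2 ub that)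
  \<comment> \<open>A Taylor remainder estimate for each coefficient; its constant decays
    geometrically in the number of quanta and can therefore be summed to a norm estimate.\<close>
  have quot: "geom_bound \<rho>'' (\<bar>x - t\<bar> * K) (\<lambda>m. (u x m - u t m) / of_real (x - t) - ?A (u t) m)"
    if x: "x \<noteq> t" "\<bar>x - t\<bar> \<le> 1" for x
    unfolding geom_bound_def
  proof
    fix m :: "'n \<Rightarrow> nat"
    define B where "B = K * \<rho>'' ^ (\<Sum>i\<in>UNIV. m i)"
    define S where "S = closed_segment t x"
    have S: "\<bar>y - t\<bar> \<le> \<bar>x - t\<bar>" if "y \<in> S" for y
      using that by (auto simp: S_def closed_segment_eq_real_ivl split: if_splits)
    \<comment> \<open>First use of the mean value inequality: the bound on the second derivative
      makes the first derivative Lipschitz along the segment.\<close>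
    have 1: "norm (?A (u y) m - ?A (u t) m) \<le> B * norm (y - t)" if "y \<in> S" for y
    proof (rule differentiable_bound[where S = S and f' = "\<lambda>z h. h *\<^sub>R ?A (?A (u z)) m"])
      fix z assume z: "z \<in> S"
      show "((\<lambda>y. ?A (u y) m) has_derivative (\<lambda>h. h *\<^sub>R ?A (?A (u z)) m)) (at z within S)"
        using has_vector_derivative_squeeze_gen[OF der]
        unfolding has_vector_derivative_def by (rule has_derivative_at_withinI)
      have "norm (?A (?A (u z)) m) \<le> B"
        unfolding B_def using geom_boundD[OF AA] S[OF z] x by auto
      then show "onorm (\<lambda>h. h *\<^sub>R ?A (?A (u z)) m) \<le> B"
        by (intro onorm_le) (simp add: mult.commute[of B] mult_left_mono)
    qed (use that in \<open>auto simp: S_def\<close>)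
    have B0: "0 \<le> B"
      unfolding B_def using geom_boundD[OF AA, of t m] by (auto intro: order_trans[OF norm_ge_zero])
    \<comment> \<open>Second use: a Lipschitz derivative makes the linearization error quadratic in
      \<open>x - t\<close>.\<close>
    have "norm (u x m - u t m - (x - t) *\<^sub>R ?A (u t) m) \<le> norm (x - t) * (B * \<bar>x - t\<bar>)"
    proof (rule vector_differentiable_bound_linearization[where S = S])
      show "((\<lambda>y. u y m) has_vector_derivative ?A (u y) m) (at y within S)" for y
        by (rule has_vector_derivative_at_within[OF der])
      show "norm (?A (u y) m - ?A (u t) m) \<le> B * \<bar>x - t\<bar>" if "y \<in> S" for y
        using order_trans[OF 1[OF that] mult_left_mono[OF _ B0]] S[OF that] by simp
    qed (auto simp: S_def)
    moreover have "(u x m - u t m) / of_real (x - t) - ?A (u t) m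
        = (u x m - u t m - (x - t) *\<^sub>R ?A (u t) m) / of_real (x - t)"
      using x by (simp add: field_simps scaleR_conv_of_real del: of_real_diff)
    ultimately have "norm ((u x m - u t m) / of_real (x - t) - ?A (u t) m) \<le> B * \<bar>x - t\<bar>"
      using x by (simp add: norm_divide pos_divide_le_eq mult.commute del: of_real_diff)
    then show "cmod ((u x m - u t m) / of_real (x - t) - ?A (u t) m) \<le> \<bar>x - t\<bar> * K * \<rho>'' ^ (\<Sum>i\<in>UNIV. m i)"
      by (simp add: B_def mult_ac)
  qed
  define M where "M = sqrt ((1 / (1 - \<rho>''\<^sup>2)) ^ CARD('n))"
  have ev: "\<forall>\<^sub>F x in at t. norm (fock_norm (\<lambda>m. (u x m - u t m) / of_real (x - t) - ?A (u t) m)) \<le> \<bar>x - t\<bar> * K * M"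
    unfolding eventually_at
    using geom_bound_fock_norm(2)[OF quot \<rho>''(2,3)]
    by (intro exI[of _ 1]) (auto simp: dist_real_def M_def)
  have "((\<lambda>x. \<bar>x - t\<bar> * K * M) \<longlongrightarrow> \<bar>t - t\<bar> * K * M) (at t)"
    by (intro tendsto_intros)
  then have "((\<lambda>x. fock_norm (\<lambda>m. (u x m - u t m) / of_real (x - t) - ?A (u t) m)) \<longlongrightarrow> 0) (at t)"
    by (intro Lim_null_comparison[OF ev]) simp
  moreover have "u t \<in> decaying" using \<rho> ub[of t] by (auto simp: decaying_def)
  ultimately show "\<exists>h. (u t, h) \<in> op_closure ?A \<and>
      ((\<lambda>x. fock_norm (\<lambda>m. (u x m - u t m) / of_real (x - t) - h m)) \<longlongrightarrow> 0) (at t)"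
    using decaying_op_closure by blast
qed

section \<open>Squeezed states\<close>

text \<open>\<open>squeeze_norm k\<close> is \<open>sqrt ((2k)!) / (2^k k!)\<close>, written as a product to make the recursion immediate.\<close>

definition squeeze_norm :: "nat \<Rightarrow> real" where
  "squeeze_norm k = (\<Prod>i<k. sqrt ((2 * real i + 1) / (2 * real i + 2)))"

lemma squeeze_norm_Suc: "sqrt (2 * real k + 2) * squeeze_norm (Suc k) = sqrt (2 * real k + 1) * squeeze_norm k"
  by (simp add: squeeze_norm_def real_sqrt_divide)

lemma squeeze_norm_bounds: "0 \<le> squeeze_norm k" "squeeze_norm k \<le> 1"
  unfolding squeeze_norm_def by (auto intro!: prod_nonneg prod_le_1)

text \<open>The occupation-number amplitudes of the one-mode squeezed vacuum. The factor
  \<open>1 / sqrt (cosh t)\<close> contributes the zero-point term in the evolution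
  equation.\<close>

definition squeeze_amp :: "real \<Rightarrow> nat \<Rightarrow> real" where
  "squeeze_amp t m = (if even m then (- tanh t) ^ (m div 2) * squeeze_norm (m div 2) / sqrt (cosh t) else 0)"

lemma squeeze_amp_odd [simp]: "odd m \<Longrightarrow> squeeze_amp t m = 0"
  by (simp add: squeeze_amp_def)

lemma squeeze_amp_double: "squeeze_amp t (2 * k) = (- tanh t) ^ k * squeeze_norm k / sqrt (cosh t)"
  by (simp add: squeeze_amp_def)

text \<open>The relation between annihilation and creation on the squeezed vacuum, in coefficients.
  For even \<open>m\<close> both sides vanish by parity, except that at \<open>m = 0\<close>, where
  \<open>m - 1\<close> truncates to 0, the factor \<open>sqrt 0\<close> does it.\<close>

lemma squeeze_amp_rec:
  "sqrt (real m + 1) * squeeze_amp t (m + 1) = - tanh t * (sqrt (real m) * squeeze_amp t (m - 1))"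
proof (cases "even m")
  case True
  then show ?thesis by (cases "m = 0") auto
next
  case False
  then obtain k where m: "m = 2 * k + 1" by (elim oddE)
  have "sqrt (2 * real k + 2) * squeeze_amp t (2 * Suc k)
      = (- tanh t) ^ Suc k * (sqrt (2 * real k + 2) * squeeze_norm (Suc k)) / sqrt (cosh t)"
    unfolding squeeze_amp_double by simp
  also have "\<dots> = - tanh t * (sqrt (2 * real k + 1) * squeeze_amp t (2 * k))"
    unfolding squeeze_norm_Suc squeeze_amp_double by simp
  finally show ?thesis unfolding m by (simp add: add.commute)
qed

text \<open>There is one factor \<open>tanh t\<close> for every two quanta, hence the square in the
  hypothesis; the remaining factors are at most 1.\<close>

lemma squeeze_amp_bound:
  assumes "\<bar>tanh t\<bar> \<le> \<rho>\<^sup>2" "0 \<le> \<rho>"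
  shows "\<bar>squeeze_amp t m\<bar> \<le> \<rho> ^ m"
proof (cases "even m")
  case True
  then obtain k where m: "m = 2 * k" by (elim evenE)
  have "1 \<le> sqrt (cosh t)" using cosh_real_ge_1[of t] by simp
  then have "squeeze_norm k / sqrt (cosh t) \<le> 1"
    using squeeze_norm_bounds[of k] by (intro divide_le_eq_1[THEN iffD2]) linarith
  then have "\<bar>tanh t\<bar> ^ k * (squeeze_norm k / sqrt (cosh t)) \<le> (\<rho>\<^sup>2) ^ k * 1"
    using assms squeeze_norm_bounds[of k] cosh_real_ge_1[of t] by (intro mult_mono power_mono) auto
  then show ?thesis
    unfolding m squeeze_amp_double using squeeze_norm_bounds[of k] cosh_real_ge_1[of t]
    by (simp add: abs_mult power_abs power_mult abs_divide)
qed (use assms in auto)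

text \<open>The right-hand side is the coefficient form of the squeezing generator with unit
  parameter. At \<open>m = 2 * k\<close> the recursions express both neighbours through powers of
  \<open>-T\<close> and a common factor \<open>p\<close>. The derivative \<open>1 - T^2\<close> of
  \<open>tanh\<close> yields the terms with weight \<open>k\<close>, and the derivative of the
  normalization yields the missing half.\<close>

lemma squeeze_amp_deriv:
  "((\<lambda>t. squeeze_amp t m) has_field_derivative
    (sqrt (real m + 1) * (sqrt (real m + 2) * squeeze_amp t (m + 2))
      - sqrt (real m) * (sqrt (real (m - 1)) * squeeze_amp t (m - 2))) / 2) (at t)"
proof (cases "even m")
  case False
  \<comment> \<open>At \<open>m = 1\<close> the truncated index \<open>m - 2\<close> is 0, where the
    amplitude is nonzero; the factor \<open>sqrt (real (m - 1))\<close> removes it.\<close>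
  then show ?thesis by (cases "m = 1") (auto simp: squeeze_amp_def)
next
  case True
  then obtain k where m: "m = 2 * k" by (elim evenE)
  define T where "T = tanh t"
  define c where "c = sqrt (cosh t)"
  have c: "0 < c" "c\<^sup>2 = cosh t" using cosh_real_pos[of t] by (auto simp: c_def less_imp_le)
  define p where "p = squeeze_norm k / c"
  have sinh: "sinh t = T * c\<^sup>2" using c by (simp add: T_def tanh_def)
  have up: "sqrt (real m + 1) * (sqrt (real m + 2) * squeeze_amp t (m + 2))
      = (2 * real k + 1) * ((- T) ^ Suc k * p)"
  proof -
    have "sqrt (real m + 2) * squeeze_amp t (m + 2) = - T * (sqrt (real m + 1) * squeeze_amp t m)"
      using squeeze_amp_rec[of "m + 1" t] by (simp add: T_def add.commute)
    then have "sqrt (real m + 1) * (sqrt (real m + 2) * squeeze_amp t (m + 2))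
        = (sqrt (real m + 1) * sqrt (real m + 1)) * (- T * squeeze_amp t m)"
      by (simp only: mult_ac)
    then show ?thesis
      unfolding m squeeze_amp_double by (simp add: T_def c_def p_def)
  qed
  have down: "sqrt (real m) * (sqrt (real (m - 1)) * squeeze_amp t (m - 2))
      = 2 * real k * ((- T) ^ (k - 1) * p)"
  proof (cases k)
    case (Suc k')
    have "squeeze_amp t (2 * k') = (- T) ^ k' * squeeze_norm k' / c"
      by (simp add: squeeze_amp_double T_def c_def)
    then have "sqrt (real m) * (sqrt (real (m - 1)) * squeeze_amp t (m - 2))
       = sqrt (2 * real k' + 2) * ((- T) ^ k' * (sqrt (2 * real k' + 1) * squeeze_norm k') / c)"
      by (simp add: m Suc add.commute)
    also have "\<dots> = (sqrt (2 * real k' + 2) * sqrt (2 * real k' + 2)) * ((- T) ^ k' * squeeze_norm k / c)"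
      unfolding squeeze_norm_Suc[symmetric] Suc by simp
    finally show ?thesis by (simp add: Suc p_def)
  qed (simp add: m)
  have "((\<lambda>t. (- tanh t) ^ k * squeeze_norm k / sqrt (cosh t)) has_field_derivative
     ((real k * (- T) ^ (k - 1) * (- (1 - T\<^sup>2)) * squeeze_norm k) * c
       - ((- T) ^ k * squeeze_norm k) * (sinh t * (inverse c / 2))) / (c * c)) (at t)"
  proof -
    have D1: "((\<lambda>t. (- tanh t) ^ k * squeeze_norm k) has_field_derivative
        real k * (- T) ^ (k - 1) * (- (1 - T\<^sup>2)) * squeeze_norm k) (at t)"
      unfolding T_def by (auto intro!: derivative_eq_intros simp: cosh_real_pos[THEN less_imp_neq, symmetric])
    have D2: "((\<lambda>t. sqrt (cosh t)) has_field_derivative sinh t * (inverse c / 2)) (at t)"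
      unfolding c_def using DERIV_chain2[OF DERIV_real_sqrt[OF cosh_real_pos] has_field_derivative_cosh[OF DERIV_ident], of t]
      by (simp add: mult_ac)
    have "sqrt (cosh t) \<noteq> 0" using c(1) by (simp add: c_def)
    from DERIV_divide[OF D1 D2 this] show ?thesis by (simp only: T_def c_def)
  qed
  moreover have "((real k * (- T) ^ (k - 1) * (- (1 - T\<^sup>2)) * squeeze_norm k) * c
       - ((- T) ^ k * squeeze_norm k) * (sinh t * (inverse c / 2))) / (c * c)
     = real k * (- T) ^ (k - 1) * (- (1 - T\<^sup>2)) * p - ((- T) ^ k * p) * T / 2"
    unfolding sinh p_def using c(1) by (simp add: field_simps power2_eq_square)
  moreover have "\<dots> = ((2 * real k + 1) * ((- T) ^ Suc k * p) - 2 * real k * ((- T) ^ (k - 1) * p)) / 2"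
    \<comment> \<open>For \<open>k = 0\<close> the truncated exponent \<open>k - 1\<close> is
      harmless because its term carries the factor \<open>k\<close>.\<close>
    by (cases k) (auto simp: field_simps power2_eq_square)
  ultimately show ?thesis
    unfolding up down by (simp only: m squeeze_amp_double)
qed

section \<open>Multimode squeezed states and identification of the probe\<close>

definition squeezed_state :: "('n::finite \<Rightarrow> real) \<Rightarrow> 'n fock" where
  "squeezed_state r = (\<lambda>m. complex_of_real (\<Prod>i\<in>UNIV. squeeze_amp (r i) (m i)))"

lemma squeezed_state_split:
  "squeezed_state r m = of_real (squeeze_amp (r j) (m j)) * of_real (\<Prod>i\<in>UNIV - {j}. squeeze_amp (r i) (m i))"
  unfolding squeezed_state_def by (subst prod.remove[of _ j]) auto

lemma squeezed_state_upd:
  "squeezed_state (r(j := x)) (m(j := k))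
    = of_real (squeeze_amp x k) * of_real (\<Prod>i\<in>UNIV - {j}. squeeze_amp (r i) (m i))"
  unfolding squeezed_state_split[of _ _ j] by (simp cong: prod.cong_simp)

lemma squeezed_state_odd: "odd (m j) \<Longrightarrow> squeezed_state r m = 0"
  by (simp add: squeezed_state_split[of _ _ j])

lemma squeezed_state_geom_bound:
  fixes r :: "'n::finite \<Rightarrow> real"
  assumes "\<And>i. \<bar>tanh (r i)\<bar> \<le> \<rho>\<^sup>2" "0 \<le> \<rho>"
  shows "geom_bound \<rho> 1 (squeezed_state r)"
  unfolding geom_bound_def
proof
  fix m :: "'n \<Rightarrow> nat"
  have "cmod (squeezed_state r m) = (\<Prod>i\<in>UNIV. \<bar>squeeze_amp (r i) (m i)\<bar>)"
    unfolding squeezed_state_def by (simp only: norm_of_real abs_prod)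
  also have "\<dots> \<le> (\<Prod>i\<in>UNIV. \<rho> ^ m i)"
    using assms by (intro prod_mono conjI squeeze_amp_bound) auto
  finally show "cmod (squeezed_state r m) \<le> 1 * \<rho> ^ (\<Sum>i\<in>UNIV. m i)"
    by (simp add: power_sum)
qed

text \<open>One ratio for all bounded parameters, as \<open>evolution_curveI\<close> demands a bound
  that is uniform over a time window.\<close>

lemma squeezed_state_geom_bound_uniform:
  fixes B :: real
  obtains \<rho> where "0 < \<rho>" "\<rho> < 1"
    "\<And>r::'n::finite \<Rightarrow> real. (\<And>i. \<bar>r i\<bar> \<le> B) \<Longrightarrow> geom_bound \<rho> 1 (squeezed_state r)"
proof
  \<comment> \<open>Adding 1 keeps the argument of \<open>tanh\<close> positive for every
    \<open>B\<close>, so that \<rho> is positive; the square root matches the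
    \<open>\<rho>^2\<close> in the amplitude bound.\<close>
  define \<rho> where "\<rho> = sqrt (tanh (\<bar>B\<bar> + 1))"
  have T: "0 < tanh (\<bar>B\<bar> + 1)" "tanh (\<bar>B\<bar> + 1) < 1" by (auto simp: tanh_real_lt_1)
  show "0 < \<rho>" "\<rho> < 1" using T by (auto simp: \<rho>_def)
  fix r :: "'n \<Rightarrow> real" assume r: "\<And>i. \<bar>r i\<bar> \<le> B"
  have "\<bar>tanh (r i)\<bar> \<le> \<rho>\<^sup>2" for i
  proof -
    have "\<bar>tanh (r i)\<bar> = tanh \<bar>r i\<bar>" by simp
    also have "\<dots> \<le> tanh (\<bar>B\<bar> + 1)" using r[of i] by (subst tanh_real_le_iff) linarith
    finally show ?thesis using T by (simp add: \<rho>_def)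
  qed
  then show "geom_bound \<rho> 1 (squeezed_state r)"
    using \<open>0 < \<rho>\<close> by (intro squeezed_state_geom_bound) auto
qed

lemma squeezed_state_decaying: "squeezed_state r \<in> decaying"
proof -
  have *: "\<bar>r i\<bar> \<le> (\<Sum>i\<in>UNIV. \<bar>r i\<bar>)" for i by (rule member_le_sum) auto
  obtain \<rho> where "0 < \<rho>" "\<rho> < 1" "geom_bound \<rho> 1 (squeezed_state r)"
    by (rule squeezed_state_geom_bound_uniform[of "\<Sum>i\<in>UNIV. \<bar>r i\<bar>", where ?'n = 'a]) (use * in blast)
  then show ?thesis by (auto simp: decaying_def)
qed

lemma squeezed_state_curve:
  fixes r :: "'n::finite \<Rightarrow> real"
  shows "evolution_curve (squeeze_gen s j) (\<lambda>t. squeezed_state (r(j := s * t)))"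
proof (rule evolution_curveI)
  fix t and m :: "'n \<Rightarrow> nat"
  let ?P = "\<Prod>i\<in>UNIV - {j}. squeeze_amp (r i) (m i)"
  let ?D = "\<lambda>x. (sqrt (real (m j) + 1) * (sqrt (real (m j) + 2) * squeeze_amp x (m j + 2))
      - sqrt (real (m j)) * (sqrt (real (m j - 1)) * squeeze_amp x (m j - 2))) / 2"
  have "((\<lambda>t. squeeze_amp (s * t) (m j)) has_field_derivative ?D (s * t) * s) (at t)"
    by (rule DERIV_chain2[OF squeeze_amp_deriv]) (auto intro!: derivative_eq_intros)
  then have "((\<lambda>t. squeeze_amp (s * t) (m j) * ?P) has_field_derivative ?D (s * t) * s * ?P) (at t)"
    by (rule DERIV_cmult_right)
  then have "((\<lambda>t. complex_of_real (squeeze_amp (s * t) (m j) * ?P)) has_vector_derivative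
      complex_of_real (?D (s * t) * s * ?P)) (at t)"
    by (rule has_vector_derivative_of_real)
  moreover have "complex_of_real (squeeze_amp (s * t) (m j) * ?P) = squeezed_state (r(j := s * t)) m" for t
    using squeezed_state_upd[of r j "s * t" m "m j"] by simp
  moreover have "complex_of_real (?D (s * t) * s * ?P) = squeeze_gen s j (squeezed_state (r(j := s * t))) m"
    unfolding squeeze_gen_def annihilation_def creation_def
    by (simp add: squeezed_state_upd field_simps numeral_2_eq_2)
  ultimately show "((\<lambda>t. squeezed_state (r(j := s * t)) m) has_vector_derivative
      squeeze_gen s j (squeezed_state (r(j := s * t))) m) (at t)"
    by simp
next
  fix t
  \<comment> \<open>The sum bounds the parameters of the idle modes; the second term bounds
    \<open>s * x\<close> over the window around \<open>t\<close>.\<close>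
  define B where "B = (\<Sum>i\<in>UNIV. \<bar>r i\<bar>) + \<bar>s\<bar> * (\<bar>t\<bar> + 1)"
  have *: "\<bar>(r(j := s * x)) i\<bar> \<le> B" if "\<bar>x - t\<bar> \<le> 1" for x i
  proof -
    have "\<bar>r i\<bar> \<le> (\<Sum>i\<in>UNIV. \<bar>r i\<bar>)" by (rule member_le_sum) auto
    moreover have "\<bar>s * x\<bar> \<le> \<bar>s\<bar> * (\<bar>t\<bar> + 1)"
      unfolding abs_mult using that by (intro mult_left_mono) auto
    moreover have "0 \<le> (\<Sum>i\<in>UNIV. \<bar>r i\<bar>)" "0 \<le> \<bar>s\<bar> * (\<bar>t\<bar> + 1)" by (auto intro: sum_nonneg)
    ultimately show ?thesis by (auto simp: B_def)
  qed
  obtain \<rho> where "0 < \<rho>" "\<rho> < 1"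
    "\<And>r::'n \<Rightarrow> real. (\<And>i. \<bar>r i\<bar> \<le> B) \<Longrightarrow> geom_bound \<rho> 1 (squeezed_state r)"
    by (rule squeezed_state_geom_bound_uniform[of B, where ?'n = 'n]) blast
  then show "\<exists>\<rho> C. 0 < \<rho> \<and> \<rho> < 1 \<and> (\<forall>x. \<bar>x - t\<bar> \<le> 1 \<longrightarrow> geom_bound \<rho> C (squeezed_state (r(j := s * x))))"
    using * by blast
qed

text \<open>Since \<open>r j = 0\<close>, the given state is the point at time 0 on the curve that
  squeezes mode \<open>j\<close>, and time 1 gives the result.\<close>

lemma op_exp_squeezed_state:
  fixes r :: "'n::finite \<Rightarrow> real"
  assumes "r j = 0"
  shows "op_exp (squeeze_gen s j) (squeezed_state r) = squeezed_state (r(j := s))"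
  using op_exp_eq[OF squeezed_state_curve[of s j r]] assms by (simp add: fun_upd_idem)

lemma squeezed_state_0: "squeezed_state (\<lambda>_. 0) = vacuum"
proof
  fix m :: "'n::finite \<Rightarrow> nat"
  have z: "squeeze_amp 0 k = (if k = 0 then 1 else 0)" for k
    by (auto simp: squeeze_amp_def squeeze_norm_def power_0_left elim!: evenE)
  show "squeezed_state (\<lambda>_. 0) m = vacuum m"
    by (auto simp: squeezed_state_def vacuum_def z fun_eq_iff)
qed

text \<open>As the modes are distinct, mode \<open>j\<close> still has parameter 0 when its own
  factor acts, so \<open>op_exp_squeezed_state\<close> applies at every step.\<close>

lemma squeezer_foldr:
  fixes r :: "'n::{finite,linorder} \<Rightarrow> real"
  assumes "distinct js"
  shows "foldr (\<lambda>j S. op_exp (squeeze_gen (r j) j) \<circ> S) js id vacuum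
    = squeezed_state (\<lambda>i. if i \<in> set js then r i else 0)"
  using assms
proof (induction js)
  case Nil
  then show ?case by (simp add: squeezed_state_0)
next
  case (Cons j js)
  then have "(\<lambda>i. if i \<in> set (j # js) then r i else 0) = (\<lambda>i. if i \<in> set js then r i else 0)(j := r j)"
    by auto
  with Cons show ?case by (simp add: op_exp_squeezed_state)
qed

lemma probe_eq: "probe r = squeezed_state r"
  unfolding probe_def squeezer_def by (subst squeezer_foldr) (auto simp: modes_def)

text \<open>The norm is conserved while one parameter varies, so the modes can be switched on one at
  a time from the vacuum. This replaces the summation of the squared amplitudes.\<close>

lemma squeezed_state_norm:
  fixes r :: "'n::finite \<Rightarrow> real"
  shows "fock_norm (squeezed_state r) = 1"
proof -
  have step: "fock_norm (squeezed_state (r(j := s))) = fock_norm (squeezed_state (r(j := 0)))" for r :: "'n \<Rightarrow> real" and j s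
    using evolution_curve_norm[OF squeezed_state_curve[of s j r], of 1 0] by simp
  have "fock_norm (squeezed_state (\<lambda>i. if i \<in> F then r i else 0)) = 1"
    if "finite F" for F :: "'n set"
    using that
  proof (induction F)
    case empty
    have "(\<lambda>m. (cmod (vacuum m))\<^sup>2) = (\<lambda>m. if m = (\<lambda>_::'n. 0::nat) then 1 else 0)"
      by (auto simp: vacuum_def)
    moreover have "(\<Sum>\<^sub>\<infinity>m. if m = (\<lambda>_::'n. 0::nat) then 1 else 0::real) = (\<Sum>\<^sub>\<infinity>m\<in>{\<lambda>_::'n. 0::nat}. 1)"
      by (rule infsum_cong_neutral) auto
    ultimately show ?case by (simp add: squeezed_state_0 fock_norm_def)
  next
    case (insert j F)
    have "(\<lambda>i. if i \<in> insert j F then r i else 0) = (\<lambda>i. if i \<in> F then r i else 0)(j := r j)"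
      "(\<lambda>i. if i \<in> F then r i else 0)(j := 0) = (\<lambda>i. if i \<in> F then r i else 0)"
      using insert(2) by auto
    with insert step show ?case by metis
  qed
  from this[of UNIV] show ?thesis by simp
qed

section \<open>Moments of the passive generators\<close>

definition pair_excitation :: "('n::finite \<Rightarrow> real) \<Rightarrow> 'n \<Rightarrow> 'n \<Rightarrow> 'n fock" where
  "pair_excitation r j k = creation j (creation k (squeezed_state r))"

lemma pair_excitation_decaying: "pair_excitation r j k \<in> decaying"
  by (simp add: pair_excitation_def decaying_creation squeezed_state_decaying)

text \<open>The amplitude recursion in mode \<open>j\<close>; the factors of the other modes are
  carried along.\<close>

lemma annihilation_squeezed_state:
  "annihilation j (squeezed_state r) = (\<lambda>m. - of_real (tanh (r j)) * creation j (squeezed_state r) m)"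
proof
  fix m
  let ?P = "complex_of_real (\<Prod>i\<in>UNIV - {j}. squeeze_amp (r i) (m i))"
  have sp: "squeezed_state r (m(j := k)) = of_real (squeeze_amp (r j) k) * ?P" for k
    using squeezed_state_upd[of r j "r j" m k] by simp
  have "annihilation j (squeezed_state r) m = of_real (sqrt (real (m j) + 1) * squeeze_amp (r j) (m j + 1)) * ?P"
    unfolding annihilation_def sp by simp
  also have "\<dots> = - of_real (tanh (r j)) * creation j (squeezed_state r) m"
    unfolding squeeze_amp_rec creation_def sp by simp
  finally show "annihilation j (squeezed_state r) m = - of_real (tanh (r j)) * creation j (squeezed_state r) m" .
qed

lemma creation_annihilation_squeezed_state:
  "creation j (annihilation k (squeezed_state r)) = (\<lambda>m. - of_real (tanh (r k)) * pair_excitation r j k m)"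
  unfolding annihilation_squeezed_state pair_excitation_def by (rule creation_scale)

fun pair_coeff :: "('n \<Rightarrow> real) \<Rightarrow> 'n generator \<Rightarrow> complex" where
  "pair_coeff r (Rot j) = - of_real (tanh (r j))"
| "pair_coeff r (BsX j k) = - of_real (tanh (r j) + tanh (r k))"
| "pair_coeff r (BsY j k) = - \<i> * of_real (tanh (r j) - tanh (r k))"

text \<open>A rotation is recorded as the pair \<open>(j, j)\<close>: it excites the same mode twice
  and so leaves every parity even, which lets one parity criterion treat all generators.\<close>

fun gen_modes :: "'n generator \<Rightarrow> 'n \<times> 'n" where
  "gen_modes (Rot j) = (j, j)"
| "gen_modes (BsX j k) = (j, k)"
| "gen_modes (BsY j k) = (j, k)"

lemma passive_op_squeezed_state:
  "passive_op \<mu> (squeezed_state r)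
    = (\<lambda>m. pair_coeff r \<mu> * pair_excitation r (fst (gen_modes \<mu>)) (snd (gen_modes \<mu>)) m)"
proof -
  have c: "pair_excitation r k j = pair_excitation r j k" for j k
    unfolding pair_excitation_def by (rule creation_commute)
  show ?thesis
    by (cases \<mu>) (auto simp: creation_annihilation_squeezed_state c algebra_simps)
qed

lemma passive_op_decaying: "f \<in> decaying \<Longrightarrow> passive_op \<mu> f \<in> decaying"
  by (cases \<mu>; simp only: passive_op.simps;
      intro decaying_add decaying_diff decaying_scale decaying_creation decaying_annihilation)

text \<open>Taking adjoints swaps \<open>j\<close> and \<open>k\<close> in a hopping term. The sum
  in \<open>BsX\<close> is invariant; in \<open>BsY\<close> the sign from the swap cancels the one
  from conjugating \<open>\<i>\<close>.\<close>

lemma passive_op_symmetric: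
  assumes "f \<in> decaying" "g \<in> decaying"
  shows "fock_inner f (passive_op \<mu> g) = fock_inner (passive_op \<mu> f) g"
proof -
  have *: "fock_inner f (creation j (annihilation k g)) = fock_inner (creation k (annihilation j f)) g" for j k
    by (simp add: fock_inner_creation_right fock_inner_annihilation_right)
  have fs: "creation j (annihilation k f) \<in> fock_space" "creation j (annihilation k g) \<in> fock_space"
    "f \<in> fock_space" "g \<in> fock_space" for j k
    using assms by (auto intro!: decaying_fock_space decaying_creation decaying_annihilation)
  show ?thesis
  proof (cases \<mu>)
    case (BsY j k)
    have "passive_op \<mu> h = (\<lambda>m. - \<i> * (creation j (annihilation k h) m + (-1) * creation k (annihilation j h) m))" for h
      using BsY by simp
    then show ?thesis
      by (simp only: fock_inner_scale_left fock_inner_scale_right fock_inner_add_left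
          fock_inner_add_right fock_space_scale fs *) (simp add: algebra_simps)
  qed (simp_all add: fock_inner_add_left fock_inner_add_right fs *)
qed

text \<open>By the commutation relation, \<open>\<parallel>a\<^sup>\<dagger> f\<parallel>\<^sup>2 = \<parallel>a f\<parallel>\<^sup>2 + \<parallel>f\<parallel>\<^sup>2 = tanh\<^sup>2 t \<parallel>a\<^sup>\<dagger> f\<parallel>\<^sup>2 + \<parallel>f\<parallel>\<^sup>2\<close>.\<close>

lemma fock_norm_creation_sq:
  assumes f: "f \<in> decaying" and a: "annihilation j f = (\<lambda>m. - of_real (tanh t) * creation j f m)"
  shows "(fock_norm (creation j f))\<^sup>2 = (cosh t)\<^sup>2 * (fock_norm f)\<^sup>2"
proof -
  have fs: "f \<in> fock_space" "creation j f \<in> fock_space" "annihilation j f \<in> fock_space"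
    "creation j (annihilation j f) \<in> fock_space"
    using f by (auto intro!: decaying_fock_space decaying_creation decaying_annihilation)
  have "fock_inner (creation j f) (creation j f) = fock_inner f (annihilation j (creation j f))"
    by (rule fock_inner_annihilation_right[symmetric])
  also have "\<dots> = fock_inner (annihilation j f) (annihilation j f) + fock_inner f f"
    unfolding annihilation_creation_same
    by (simp add: fock_inner_add_right fs fock_inner_creation_right)
  finally have "complex_of_real ((fock_norm (creation j f))\<^sup>2)
      = complex_of_real ((fock_norm (annihilation j f))\<^sup>2 + (fock_norm f)\<^sup>2)"
    by (simp only: fock_inner_self fs of_real_add)
  then have 1: "(fock_norm (creation j f))\<^sup>2 = (fock_norm (annihilation j f))\<^sup>2 + (fock_norm f)\<^sup>2"
    by (simp only: of_real_eq_iff)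
  have "fock_norm (annihilation j f) = \<bar>tanh t\<bar> * fock_norm (creation j f)"
    unfolding a fock_norm_scale by simp
  with 1 have "(1 - (tanh t)\<^sup>2) * (fock_norm (creation j f))\<^sup>2 = (fock_norm f)\<^sup>2"
    by (simp add: power_mult_distrib algebra_simps)
  moreover have "(cosh t)\<^sup>2 * (1 - (tanh t)\<^sup>2) = 1"
  proof -
    have "(cosh t)\<^sup>2 * (tanh t)\<^sup>2 = (sinh t)\<^sup>2"
      by (simp add: tanh_def flip: power_mult_distrib)
    then show ?thesis
      unfolding right_diff_distrib using cosh_square_eq[of t] by simp
  qed
  ultimately show ?thesis by (metis mult.assoc mult_1)
qed

text \<open>Two applications of \<open>fock_norm_creation_sq\<close>. The relation between
  annihilation and creation in mode \<open>j\<close> survives a creation in the different mode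
  \<open>k\<close>, since the two commute.\<close>

lemma pair_excitation_norm:
  assumes "j \<noteq> k"
  shows "(fock_norm (pair_excitation r j k))\<^sup>2 = (cosh (r j))\<^sup>2 * (cosh (r k))\<^sup>2"
proof -
  let ?\<psi> = "squeezed_state r"
  have "annihilation j (creation k ?\<psi>) = (\<lambda>m. - of_real (tanh (r j)) * creation j (creation k ?\<psi>) m)"
    unfolding annihilation_creation_other[OF assms] annihilation_squeezed_state
    by (simp only: creation_scale creation_commute[of k j])
  then have "(fock_norm (pair_excitation r j k))\<^sup>2 = (cosh (r j))\<^sup>2 * (fock_norm (creation k ?\<psi>))\<^sup>2"
    unfolding pair_excitation_def
    by (intro fock_norm_creation_sq decaying_creation squeezed_state_decaying)
  also have "(fock_norm (creation k ?\<psi>))\<^sup>2 = (cosh (r k))\<^sup>2"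
    using fock_norm_creation_sq[OF squeezed_state_decaying annihilation_squeezed_state]
    by (simp add: squeezed_state_norm)
  finally show ?thesis .
qed

text \<open>The right-hand side is the parity of the number of indices among \<open>j\<close>, \<open>k\<close> that equal \<open>i\<close>.\<close>

lemma pair_excitation_parity:
  assumes "pair_excitation r j k m \<noteq> 0"
  shows "odd (m i) \<longleftrightarrow> (i = j) \<noteq> (i = k)"
proof -
  let ?m = "(m(j := m j - 1))(k := (m(j := m j - 1)) k - 1)"
  have nz: "squeezed_state r ?m \<noteq> 0" "m j \<noteq> 0" "(m(j := m j - 1)) k \<noteq> 0"
    using assms unfolding pair_excitation_def creation_def by auto
  have "even (?m i)" using nz(1) squeezed_state_odd by metis
  then show ?thesis using nz(2,3) by (auto split: if_splits)
qed

lemma fock_inner_disjoint_support: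
  assumes "\<And>m. f m \<noteq> 0 \<Longrightarrow> g m \<noteq> 0 \<Longrightarrow> False"
  shows "fock_inner f g = 0"
proof -
  have "cnj (f m) * g m = 0" for m using assms[of m] by auto
  then show ?thesis unfolding fock_inner_def by (rule infsum_0)
qed

text \<open>The mode \<open>i\<close> witnesses different occupation parities, hence disjoint
  supports.\<close>

lemma pair_excitation_orthogonal:
  assumes "((i = j) \<noteq> (i = k)) \<noteq> ((i = j') \<noteq> (i = k'))"
  shows "fock_inner (pair_excitation r j k) (pair_excitation r j' k') = 0"
  using assms pair_excitation_parity[of r _ _ _ i] by (intro fock_inner_disjoint_support) metis

lemma squeezed_state_pair_orthogonal:
  assumes "j \<noteq> k"
  shows "fock_inner (squeezed_state r) (pair_excitation r j k) = 0"
  using assms squeezed_state_odd[of _ j r] pair_excitation_parity[of r j k _ j]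
  by (intro fock_inner_disjoint_support) blast

text \<open>Moving the outer generator to the left of the inner product turns the mean commutator
  into \<open>?z - cnj ?z\<close>, which is \<open>2 * \<i>\<close> times the imaginary
  part.\<close>

lemma mean_comm_eq:
  "mean_comm r \<mu> \<nu> = of_real (Im (fock_inner (passive_op \<mu> (squeezed_state r)) (passive_op \<nu> (squeezed_state r))))"
proof -
  let ?\<psi> = "squeezed_state r"
  let ?z = "fock_inner (passive_op \<mu> ?\<psi>) (passive_op \<nu> ?\<psi>)"
  have d: "passive_op \<mu> ?\<psi> \<in> decaying" "passive_op \<nu> ?\<psi> \<in> decaying"
    by (simp_all add: passive_op_decaying squeezed_state_decaying)
  have "expval ?\<psi> (commutator (passive_op \<mu>) (passive_op \<nu>))
    = fock_inner ?\<psi> (passive_op \<mu> (passive_op \<nu> ?\<psi>)) - fock_inner ?\<psi> (passive_op \<nu> (passive_op \<mu> ?\<psi>))"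
    unfolding expval_def commutator_def
    by (intro fock_inner_diff_right decaying_fock_space passive_op_decaying squeezed_state_decaying)
  also have "\<dots> = ?z - cnj ?z"
    using d by (simp add: passive_op_symmetric squeezed_state_decaying
        fock_inner_commute[of "passive_op \<nu> ?\<psi>" "passive_op \<mu> ?\<psi>"])
  also have "\<dots> = 2 * \<i> * of_real (Im ?z)" by (simp add: complex_eq_iff)
  finally show ?thesis unfolding mean_comm_def probe_eq by simp
qed

lemma mean_comm_antisym: "mean_comm r \<nu> \<mu> = - mean_comm r \<mu> \<nu>"
  unfolding mean_comm_eq
  by (subst fock_inner_commute) simp

lemma mean_comm_orthogonal:
  assumes "((i = fst (gen_modes \<mu>)) \<noteq> (i = snd (gen_modes \<mu>)))
    \<noteq> ((i = fst (gen_modes \<nu>)) \<noteq> (i = snd (gen_modes \<nu>)))"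
  shows "mean_comm r \<mu> \<nu> = 0"
  unfolding mean_comm_eq passive_op_squeezed_state fock_inner_scale_left fock_inner_scale_right
  using pair_excitation_orthogonal[OF assms] by simp

text \<open>Parity cannot separate two rotations, as both preserve all parities. They commute
  because number operators are diagonal in the occupation basis.\<close>

lemma mean_comm_Rot_Rot: "mean_comm r (Rot j) (Rot l) = 0"
proof -
  have "passive_op (Rot i) f m = of_nat (m i) * f m" for i :: 'a and f m
  proof (cases "m i = 0")
    case False
    then have "real (m i - 1) + 1 = real (m i)" by simp
    with False show ?thesis
      unfolding passive_op.simps annihilation_def creation_def
      by (simp add: mult.assoc[symmetric] of_real_mult[symmetric] del: of_real_mult)
  qed (simp add: creation_def)
  then have "commutator (passive_op (Rot j)) (passive_op (Rot l)) f = (\<lambda>_. 0)" for f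
    unfolding commutator_def by (simp add: fun_eq_iff del: passive_op.simps)
  then show ?thesis
    unfolding mean_comm_def expval_def fock_inner_def by simp
qed

text \<open>Both quadratures excite the same pair, with coefficients a quarter turn apart in phase,
  so the inner product is purely imaginary. Multiplying the difference of squared
  \<open>tanh\<close> by the squared \<open>cosh\<close> factors leaves the product of the addition
  formulas for \<open>sinh\<close>.\<close>

lemma mean_comm_BsX_BsY:
  assumes "j \<noteq> k"
  shows "mean_comm r (BsX j k) (BsY j k) = of_real (sinh (r j + r k) * sinh (r j - r k))"
proof -
  let ?N = "(fock_norm (pair_excitation r j k))\<^sup>2"
  have "mean_comm r (BsX j k) (BsY j k) = of_real ((tanh (r j) + tanh (r k)) * (tanh (r j) - tanh (r k)) * ?N)"
    unfolding mean_comm_eq passive_op_squeezed_state fock_inner_scale_left fock_inner_scale_right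
      gen_modes.simps fst_conv snd_conv fock_inner_self[OF decaying_fock_space[OF pair_excitation_decaying]]
    by (simp add: algebra_simps)
  also have "(tanh (r j) + tanh (r k)) * (tanh (r j) - tanh (r k)) * ?N = sinh (r j + r k) * sinh (r j - r k)"
    unfolding pair_excitation_norm[OF assms] tanh_def sinh_add sinh_diff
    using cosh_real_pos[of "r j"] cosh_real_pos[of "r k"]
    by (simp add: field_simps power2_eq_square)
  finally show ?thesis .
qed

text \<open>For distinct modes the pair excitation is orthogonal to the state, so the mean vanishes
  and the variance is the squared norm of the generator applied to the state.\<close>

lemma fisher_weight_eq:
  assumes "fst (gen_modes \<mu>) \<noteq> snd (gen_modes \<mu>)"
  shows "fisher_weight r \<mu> = 4 * (cmod (pair_coeff r \<mu>))\<^sup>2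
    * (fock_norm (pair_excitation r (fst (gen_modes \<mu>)) (snd (gen_modes \<mu>))))\<^sup>2"
proof -
  let ?\<psi> = "squeezed_state r"
  have "expval (probe r) (passive_op \<mu>) = 0"
    unfolding expval_def probe_eq passive_op_squeezed_state fock_inner_scale_right
    using squeezed_state_pair_orthogonal[OF assms] by simp
  then have c: "centred r \<mu> = passive_op \<mu>"
    by (simp add: centred_def fun_eq_iff)
  have "expval (probe r) (centred r \<mu> \<circ> centred r \<mu>) = fock_inner (passive_op \<mu> ?\<psi>) (passive_op \<mu> ?\<psi>)"
    unfolding c expval_def probe_eq comp_def
    by (intro passive_op_symmetric passive_op_decaying squeezed_state_decaying)
  also have "\<dots> = of_real ((fock_norm (passive_op \<mu> ?\<psi>))\<^sup>2)"
    by (intro fock_inner_self decaying_fock_space passive_op_decaying squeezed_state_decaying)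
  finally show ?thesis
    unfolding fisher_weight_def passive_op_squeezed_state fock_norm_scale
    by (simp only: Re_complex_of_real power_mult_distrib mult.assoc)
qed

text \<open>Equality in the uncertainty relation: the two quadratures send the state to multiples of
  one vector, giving weights \<open>4 * ?a^2 * ?N\<close> and \<open>4 * ?b^2 * ?N\<close> against
  the commutator \<open>?a * ?b * ?N\<close>.\<close>

lemma fisher_weight_product:
  assumes "j \<noteq> k"
  shows "(mean_comm r (BsX j k) (BsY j k))\<^sup>2
    = complex_of_real (1 / 16 * fisher_weight r (BsX j k) * fisher_weight r (BsY j k))"
proof -
  let ?a = "tanh (r j) + tanh (r k)" and ?b = "tanh (r j) - tanh (r k)"
  let ?N = "(fock_norm (pair_excitation r j k))\<^sup>2"
  have X: "fisher_weight r (BsX j k) = 4 * ?a\<^sup>2 * ?N"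
    using fisher_weight_eq[of "BsX j k" r] assms by (simp del: of_real_add)
  have Y: "fisher_weight r (BsY j k) = 4 * ?b\<^sup>2 * ?N"
    using fisher_weight_eq[of "BsY j k" r] assms by (simp add: norm_mult del: of_real_diff)
  have "mean_comm r (BsX j k) (BsY j k) = of_real (?a * ?b * ?N)"
    unfolding mean_comm_eq passive_op_squeezed_state fock_inner_scale_left fock_inner_scale_right
      gen_modes.simps fst_conv snd_conv fock_inner_self[OF decaying_fock_space[OF pair_excitation_decaying]]
    by (simp add: algebra_simps)
  then show ?thesis unfolding X Y by (simp only: of_real_power[symmetric]) (simp add: power2_eq_square)
qed

section \<open>The block form of the tensor\<close>

text \<open>Grouping a basis into blocks with vanishing cross entries makes the matrix block
  diagonal. \<open>sorted_wrt\<close> states the vanishing for every earlier and later block, which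
  is what the induction on the list peels off.\<close>

lemma mat_concat_eq_diag_block_mat:
  assumes "sorted_wrt (\<lambda>b c. \<forall>x\<in>set b. \<forall>y\<in>set c. M x y = 0 \<and> M y x = 0) bs"
  shows "Matrix.mat (length (concat bs)) (length (concat bs)) (\<lambda>(p, q). M (concat bs ! p) (concat bs ! q))
    = diag_block_mat (map (\<lambda>b. Matrix.mat (length b) (length b) (\<lambda>(p, q). M (b ! p) (b ! q))) bs)"
  using assms
proof (induction bs)
  case Nil
  show ?case by (rule eq_matI) simp_all
next
  case (Cons b bs)
  let ?D = "Matrix.mat (length (concat bs)) (length (concat bs)) (\<lambda>(p, q). M (concat bs ! p) (concat bs ! q))"
  have IH: "diag_block_mat (map (\<lambda>b. Matrix.mat (length b) (length b) (\<lambda>(p, q). M (b ! p) (b ! q))) bs) = ?D"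
    using Cons by simp
  have z: "M x y = 0" "M y x = 0" if "x \<in> set b" "y \<in> set (concat bs)" for x y
    using Cons.prems that by auto
  have zn: "M (b ! p) (concat bs ! q) = 0" "M (concat bs ! q) (b ! p) = 0"
    if "p < length b" "q < length (concat bs)" for p q
    using z[OF nth_mem nth_mem, OF that] by auto
  show ?case
    unfolding list.map diag_block_mat.simps IH Let_def
    by (rule eq_matI) (auto simp: nth_append zn simp del: length_concat)
qed

text \<open>In this form membership and distinctness follow from standard facts on
  \<open>filter\<close> and \<open>List.product\<close>.\<close>

lemma mode_pairs_eq_filter: "mode_pairs = filter (\<lambda>(j, k). j < k) (List.product modes modes)"
proof -
  have inner: "concat (map (\<lambda>k. if j < k then [(j, k)] else []) ys) = filter (\<lambda>(j, k). j < k) (map (Pair j) ys)"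
    for j :: 'a and ys by (induction ys) auto
  have "concat (map (\<lambda>j. concat (map (\<lambda>k. if j < k then [(j, k)] else []) ys)) xs)
      = filter (\<lambda>(j, k). j < k) (List.product xs ys)" for xs ys :: "'a list"
    by (induction xs) (simp_all add: inner)
  then show ?thesis unfolding mode_pairs_def .
qed

lemma passive_tensor_eq_diag_block_mat:
  fixes r :: "'n::{finite,linorder} \<Rightarrow> real"
  shows "passive_tensor r =
      diag_block_mat (0\<^sub>m CARD('n) CARD('n) #
        map (\<lambda>(j, k). mat_of_rows_list 2
            [[0, mean_comm r (BsX j k) (BsY j k)],
             [- mean_comm r (BsX j k) (BsY j k), 0]])
          mode_pairs)"
proof -
  let ?pair = "\<lambda>(j, k). [BsX j k, BsY j k]"
  let ?bs = "map Rot modes # map ?pair mode_pairs :: 'n generator list list"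
  let ?P = "\<lambda>b c. \<forall>x\<in>set b. \<forall>y\<in>set c. mean_comm r x y = 0 \<and> mean_comm r y x = 0"
  have lt: "j < k" if "(j, k) \<in> set mode_pairs" for j k :: 'n
    using that by (auto simp: mode_pairs_eq_filter)
  have dist: "distinct (mode_pairs :: ('n \<times> 'n) list)"
    unfolding mode_pairs_eq_filter by (intro distinct_filter distinct_product) (simp_all add: modes_def)
  have sym0: "mean_comm r y x = 0" if "mean_comm r x y = 0" for x y
    using mean_comm_antisym[of r x y] that by simp
  have rot: "mean_comm r (Rot l) x = 0" if "x \<in> set (?pair jk)" "jk \<in> set mode_pairs" for l x jk
  proof -
    obtain j k where jk: "jk = (j, k)" by (cases jk)
    have "gen_modes x = (j, k)" using that(1) by (auto simp: jk)
    moreover have "j < k" using that(2) jk lt by blast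
    \<comment> \<open>Mode \<open>j\<close> separates them: its parity is odd after the pair
      excitation and even after a rotation.\<close>
    ultimately show ?thesis by (intro mean_comm_orthogonal[of j]) auto
  qed
  have pairs: "mean_comm r x y = 0"
    if "x \<in> set (?pair jk)" "y \<in> set (?pair jk')" "jk \<in> set mode_pairs" "jk' \<in> set mode_pairs" "jk \<noteq> jk'"
    for x y jk jk'
  proof -
    obtain j k j' k' where jk: "jk = (j, k)" "jk' = (j', k')" by (cases jk, cases jk')
    have g: "gen_modes x = (j, k)" "gen_modes y = (j', k')" using that(1,2) by (auto simp: jk)
    have l: "j < k" "j' < k'" using that(3,4) jk lt by blast+
    \<comment> \<open>For distinct modes the parity pattern determines the unordered pair, and the
      ordering \<open>j < k\<close> then determines the ordered one.\<close>
    have "\<exists>i. ((i = j) \<noteq> (i = k)) \<noteq> ((i = j') \<noteq> (i = k'))"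
    proof (rule ccontr)
      assume "\<nexists>i. ((i = j) \<noteq> (i = k)) \<noteq> ((i = j') \<noteq> (i = k'))"
      then have "((i = j) \<noteq> (i = k)) = ((i = j') \<noteq> (i = k'))" for i by blast
      then have "i \<in> {j, k} \<longleftrightarrow> i \<in> {j', k'}" for i using l by auto
      then have "{j, k} = {j', k'}" by blast
      then have "j = j' \<and> k = k'" using l by (auto simp: doubleton_eq_iff)
      with that(5) jk show False by simp
    qed
    then obtain i where "((i = j) \<noteq> (i = k)) \<noteq> ((i = j') \<noteq> (i = k'))" by blast
    then show ?thesis by (intro mean_comm_orthogonal[of i]) (simp only: g fst_conv snd_conv not_False_eq_True)
  qed
  have "sorted_wrt ?P (map ?pair (mode_pairs :: ('n \<times> 'n) list))"
    unfolding sorted_wrt_map unfolding sorted_wrt_iff_nth_less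
  proof (intro allI impI ballI)
    let ?ps = "mode_pairs :: ('n \<times> 'n) list"
    fix a b x y
    assume ab: "a < b" "b < length ?ps"
      and xy: "x \<in> set (?pair (?ps ! a))" "y \<in> set (?pair (?ps ! b))"
    have "?ps ! a \<in> set ?ps" "?ps ! b \<in> set ?ps" "?ps ! a \<noteq> ?ps ! b"
      using ab dist by (simp_all add: nth_eq_iff_index_eq)
    from pairs[OF xy this] show "mean_comm r x y = 0 \<and> mean_comm r y x = 0"
      using sym0 by blast
  qed
  moreover have "?P (map Rot modes) c" if c: "c \<in> set (map ?pair (mode_pairs :: ('n \<times> 'n) list))" for c
  proof (intro ballI)
    fix x y
    assume x: "x \<in> set (map Rot (modes :: 'n list))" and y: "y \<in> set c"
    obtain jk where jk: "jk \<in> set mode_pairs" "c = ?pair jk"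
      using c unfolding set_map by (elim imageE)
    obtain l where l: "x = Rot l" using x unfolding set_map by (elim imageE)
    have "mean_comm r x y = 0"
      unfolding l by (rule rot[OF y[unfolded jk(2)] jk(1)])
    then show "mean_comm r x y = 0 \<and> mean_comm r y x = 0"
      using sym0 by blast
  qed
  ultimately have srt: "sorted_wrt ?P ?bs"
    unfolding sorted_wrt.simps by blast
  have basis: "passive_basis = concat ?bs" by (simp add: passive_basis_def)
  have "length (modes :: 'n list) = CARD('n)" by (simp add: modes_def)
  then have b0: "Matrix.mat (length (map Rot (modes :: 'n list))) (length (map Rot (modes :: 'n list)))
      (\<lambda>(p, q). mean_comm r (map Rot modes ! p) (map Rot modes ! q)) = 0\<^sub>m CARD('n) CARD('n)"
    by (intro eq_matI) (auto simp: mean_comm_Rot_Rot)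
  have self0: "mean_comm r x x = 0" for x
    using mean_comm_antisym[of r x x] by simp
  have anti: "mean_comm r (BsY j k) (BsX j k) = - mean_comm r (BsX j k) (BsY j k)" for j k
    by (rule mean_comm_antisym)
  have bp: "Matrix.mat (length (?pair jk)) (length (?pair jk)) (\<lambda>(p, q). mean_comm r (?pair jk ! p) (?pair jk ! q))
    = (\<lambda>(j, k). mat_of_rows_list 2 [[0, mean_comm r (BsX j k) (BsY j k)],
             [- mean_comm r (BsX j k) (BsY j k), 0]]) jk" for jk
    by (cases jk) (auto intro!: eq_matI simp: mat_of_rows_list_def self0 anti numeral_2_eq_2 less_Suc_eq)
  show ?thesis
    unfolding passive_tensor_def basis mat_concat_eq_diag_block_mat[OF srt]
    unfolding list.map map_map b0 comp_def bp ..
qed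

theorem mainTheorem10:
  fixes r :: "'n::{finite,linorder} \<Rightarrow> real"
  shows "passive_tensor r =
      diag_block_mat (0\<^sub>m CARD('n) CARD('n) #
        map (\<lambda>(j, k). mat_of_rows_list 2
            [[0, mean_comm r (BsX j k) (BsY j k)],
             [- mean_comm r (BsX j k) (BsY j k), 0]])
          mode_pairs)
    \<and> (\<forall>j k. j < k \<longrightarrow>
        mean_comm r (BsX j k) (BsY j k) = complex_of_real (sinh (r j + r k) * sinh (r j - r k))
      \<and> (mean_comm r (BsX j k) (BsY j k) = 0 \<longleftrightarrow> r j = r k \<or> r j = - r k)
      \<and> (mean_comm r (BsX j k) (BsY j k))\<^sup>2 =
          complex_of_real (1 / 16 * fisher_weight r (BsX j k) * fisher_weight r (BsY j k))
      \<and> (fisher_weight r (BsX j k) > 0 \<and> fisher_weight r (BsY j k) > 0 \<longrightarrow>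
          mean_comm r (BsX j k) (BsY j k) \<noteq> 0))
    \<and> \<not> (\<exists>(r' :: 'n \<Rightarrow> real) j k. j < k
        \<and> identifiable r' (BsX j k) \<and> identifiable r' (BsY j k)
        \<and> weakly_commuting r' (BsX j k) (BsY j k))"
proof -
  \<comment> \<open>Proved for an arbitrary spectrum, since the final claim quantifies over its own
    \<open>r'\<close>.\<close>
  have nz: "mean_comm r (BsX j k) (BsY j k) \<noteq> 0"
    if "j \<noteq> k" "fisher_weight r (BsX j k) > 0" "fisher_weight r (BsY j k) > 0"
    for r :: "'n \<Rightarrow> real" and j k
  proof
    assume "mean_comm r (BsX j k) (BsY j k) = 0"
    with fisher_weight_product[OF that(1), of r]
    have "complex_of_real (1 / 16 * fisher_weight r (BsX j k) * fisher_weight r (BsY j k)) = 0" by simp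
    then show False using that(2,3) by (simp only: of_real_eq_0_iff) simp
  qed
  have zero: "mean_comm r (BsX j k) (BsY j k) = 0 \<longleftrightarrow> r j = r k \<or> r j = - r k" if "j \<noteq> k" for j k
    unfolding mean_comm_BsX_BsY[OF that] by (simp add: eq_neg_iff_add_eq_0 disj_commute)
  have "\<not> (\<exists>(r' :: 'n \<Rightarrow> real) j k. j < k \<and> identifiable r' (BsX j k)
      \<and> identifiable r' (BsY j k) \<and> weakly_commuting r' (BsX j k) (BsY j k))"
    unfolding identifiable_def weakly_commuting_def using nz by (metis less_imp_neq)
  then show ?thesis
    using passive_tensor_eq_diag_block_mat[of r]
    by (intro conjI allI impI mean_comm_BsX_BsY zero fisher_weight_product nz) auto
qed

end
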